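(* Let $\mathcal{H}$ be a separable complex Hilbert space. For $A\in L(\mathcal{H})$ the following statements hold. (i) There exists a Bessel family $\{f_i:i\in I\}\subset\mathcal{H}$ ($I$ an at most countable index set) such that $\mathcal{A}=(A^nf_i)_{n\in\mathbb{N},\,i\in I}$ is a frame for $\mathcal{H}$ if and only if $A^*$ is similar to a strongly stable contraction. (ii) There exists a finite set $\{f_i:i\in I\}\subset\mathcal{H}$ such that $\mathcal{A}=(A^nf_i)_{n\in\mathbb{N},\,i\in I}$ is a frame for $\mathcal{H}$ if and only if $A^*$ is similar to a strongly stable contraction $T\in L(\mathcal{H})$ such that $\operatorname{ran}(\mathrm{Id}-T^*T)$ is finite-dimensional. If the conditions in (i) or (ii) are satisfied, then a contraction as in (i) or (ii), respectively, is given by $$T=S^{1/2}A^*S^{-1/2},$$ where $S$ is the frame operator of $\mathcal{A}$.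
   Context: $\mathbb{N}=\{0,1,2,\dots\}$. $L(\mathcal{H})$ is the set of bounded linear operators on $\mathcal{H}$; $\operatorname{ran}$ denotes the range. An operator $T\in L(\mathcal{H})$ is strongly stable if $T^nf\to0$ as $n\to\infty$ for each $f\in\mathcal{H}$; it is a contraction if $\|T\|\le1$. Operators $B,T\in L(\mathcal{H})$ are similar if $B=LTL^{-1}$ for some boundedly invertible $L\in L(\mathcal{H})$. The frame operator of a frame $(g_k)_{k\in K}$ is $f\mapsto\sum_{k\in K}\langle f,g_k\rangle g_k$. *)

theory Defs
  imports "HOL-Analysis.Analysis"
begin

section \<open>Complex Hilbert spaces\<close>

class complex_vector = real_vector +
  fixes scaleC :: "complex \<Rightarrow> 'a \<Rightarrow> 'a" (infixr \<open>*\<^sub>C\<close> 75)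
  assumes scaleC_add_right: "a *\<^sub>C (x + y) = a *\<^sub>C x + a *\<^sub>C y"
    and scaleC_add_left: "(a + b) *\<^sub>C x = a *\<^sub>C x + b *\<^sub>C x"
    and scaleC_scaleC: "a *\<^sub>C b *\<^sub>C x = (a * b) *\<^sub>C x"
    and scaleC_of_real: "of_real r *\<^sub>C x = r *\<^sub>R x"

text \<open>The inner product is linear in the first argument.\<close>

class complex_inner = complex_vector + real_normed_vector +
  fixes cinner :: "'a \<Rightarrow> 'a \<Rightarrow> complex"
  assumes cinner_commute: "cinner x y = cnj (cinner y x)"
    and cinner_add_left: "cinner (x + y) z = cinner x z + cinner y z"
    and cinner_scaleC_left: "cinner (a *\<^sub>C x) y = a * cinner x y"
    and cinner_ge_zero: "0 \<le> Re (cinner x x)"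
    and cinner_eq_zero_iff: "cinner x x = 0 \<longleftrightarrow> x = 0"
    and norm_eq_sqrt_cinner: "norm x = sqrt (Re (cinner x x))"

class complex_hilbert = complex_inner + complete_space

global_interpretation complex_vector:
  vector_space "scaleC :: complex \<Rightarrow> 'a \<Rightarrow> 'a::complex_vector"
  defines cspan_def: cspan = complex_vector.span
proof
  show "1 *\<^sub>C x = x" for x :: 'a
    using scaleC_of_real[of 1 x] by simp
qed (simp_all add: scaleC_add_right scaleC_add_left scaleC_scaleC)

definition finite_cdim :: "'a::complex_vector set \<Rightarrow> bool" where
  "finite_cdim V \<longleftrightarrow> (\<exists>B. finite B \<and> V = cspan B)"


section \<open>Bounded operators\<close>

definition bounded_clinear :: "('a::complex_inner \<Rightarrow> 'b::complex_inner) \<Rightarrow> bool" where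
  "bounded_clinear T \<longleftrightarrow> bounded_linear T \<and> (\<forall>c x. T (c *\<^sub>C x) = c *\<^sub>C T x)"

definition cadjoint :: "('a::complex_inner \<Rightarrow> 'b::complex_inner) \<Rightarrow> 'b \<Rightarrow> 'a" where
  "cadjoint T = (SOME T'. \<forall>x y. cinner (T x) y = cinner x (T' y))"

definition contraction :: "('a::complex_inner \<Rightarrow> 'a) \<Rightarrow> bool" where
  "contraction T \<longleftrightarrow> bounded_clinear T \<and> onorm T \<le> 1"

definition strongly_stable :: "('a::complex_inner \<Rightarrow> 'a) \<Rightarrow> bool" where
  "strongly_stable T \<longleftrightarrow> (\<forall>h. (\<lambda>n. (T ^^ n) h) \<longlonglongrightarrow> 0)"

definition similar_op :: "('a::complex_inner \<Rightarrow> 'a) \<Rightarrow> ('a \<Rightarrow> 'a) \<Rightarrow> bool" where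
  "similar_op B T \<longleftrightarrow>
     (\<exists>L. bounded_clinear L \<and> bij L \<and> bounded_clinear (inv L) \<and> B = L \<circ> T \<circ> inv L)"

definition positive_op :: "('a::complex_inner \<Rightarrow> 'a) \<Rightarrow> bool" where
  "positive_op R \<longleftrightarrow> bounded_clinear R \<and> (\<forall>x. cinner (R x) x \<in> \<real> \<and> 0 \<le> Re (cinner (R x) x))"

definition sqrt_op :: "('a::complex_inner \<Rightarrow> 'a) \<Rightarrow> 'a \<Rightarrow> 'a" where
  "sqrt_op S = (THE R. positive_op R \<and> R \<circ> R = S)"


section \<open>Bessel families and frames\<close>

text \<open>Summability is demanded explicitly because \<^const>\<open>infsum\<close> is \<open>0\<close> on non-summable families.\<close>

definition bessel :: "'k set \<Rightarrow> ('k \<Rightarrow> 'a::complex_inner) \<Rightarrow> bool" where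
  "bessel K g \<longleftrightarrow>
     (\<exists>\<beta>>0. \<forall>h. (\<lambda>k. (cmod (cinner h (g k)))\<^sup>2) summable_on K \<and>
        (\<Sum>\<^sub>\<infinity>k\<in>K. (cmod (cinner h (g k)))\<^sup>2) \<le> \<beta> * (norm h)\<^sup>2)"

definition frame :: "'k set \<Rightarrow> ('k \<Rightarrow> 'a::complex_inner) \<Rightarrow> bool" where
  "frame K g \<longleftrightarrow>
     (\<exists>\<alpha>>0. \<exists>\<beta>>0. \<forall>h. (\<lambda>k. (cmod (cinner h (g k)))\<^sup>2) summable_on K \<and>
        \<alpha> * (norm h)\<^sup>2 \<le> (\<Sum>\<^sub>\<infinity>k\<in>K. (cmod (cinner h (g k)))\<^sup>2) \<and>
        (\<Sum>\<^sub>\<infinity>k\<in>K. (cmod (cinner h (g k)))\<^sup>2) \<le> \<beta> * (norm h)\<^sup>2)"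

definition frame_operator :: "'k set \<Rightarrow> ('k \<Rightarrow> 'a::complex_inner) \<Rightarrow> 'a \<Rightarrow> 'a" where
  "frame_operator K g h = (\<Sum>\<^sub>\<infinity>k\<in>K. cinner h (g k) *\<^sub>C g k)"

definition orbit :: "('a \<Rightarrow> 'a) \<Rightarrow> ('i \<Rightarrow> 'a) \<Rightarrow> nat \<times> 'i \<Rightarrow> 'a" where
  "orbit A f = (\<lambda>(n, i). (A ^^ n) (f i))"

end

theory Submission
  imports Defs
begin

text \<open>
  Write \<open>\<A> = (A\<^sup>n f\<^sub>i)\<close>. Since \<open>\<langle>A\<^sup>* h, A\<^sup>n f\<^sub>i\<rangle> = \<langle>h, A\<^bsup>n+1\<^esup> f\<^sub>i\<rangle>\<close>, the adjoint \<open>A\<^sup>*\<close> acts on the coefficients of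
  \<open>h\<close> with respect to \<open>\<A>\<close> as a backward shift in \<open>n\<close>. Let \<open>E h = \<Sum>\<^sub>n\<^sub>,\<^sub>i \<bar>\<langle>h, A\<^sup>n f\<^sub>i\<rangle>\<bar>\<^sup>2\<close> be the energy of these
  coefficients. The shift removes the layer \<open>n = 0\<close>, so \<open>E (A\<^sup>* h) = E h - \<Sum>\<^sub>i \<bar>\<langle>h, f\<^sub>i\<rangle>\<bar>\<^sup>2\<close>, and the energy of
  \<open>A\<^sup>*\<^sup>N h\<close> is a tail of a convergent series (\<open>orbit_energy\<close>). If \<open>\<A>\<close> is a frame with frame operator \<open>S\<close>,
  then \<open>E h = \<langle>S h, h\<rangle> = \<parallel>S\<^bsup>1/2\<^esup> h\<parallel>\<^sup>2\<close> is the square of an equivalent norm. In this norm \<open>A\<^sup>*\<close> is a strongly stable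
  contraction, and \<open>T = S\<^bsup>1/2\<^esup> A\<^sup>* S\<^bsup>-1/2\<^esup>\<close> is \<open>A\<^sup>*\<close> carried over to the original norm
  (\<open>frame_contraction\<close>). Its defect is \<open>I - T\<^sup>* T = \<Sum>\<^sub>i \<langle>\<sqdot>, p\<^sub>i\<rangle> p\<^sub>i\<close> with \<open>p\<^sub>i = S\<^bsup>-1/2\<^esup> f\<^sub>i\<close>, whose range is
  finite-dimensional if there are finitely many \<open>f\<^sub>i\<close> (\<open>finite_cdim_defect\<close>).

  Conversely let \<open>A\<^sup>* = L T L\<^sup>-\<^sup>1\<close> with a strongly stable contraction \<open>T\<close>. Once the form of the defect is written as
  \<open>\<parallel>u\<parallel>\<^sup>2 - \<parallel>T u\<parallel>\<^sup>2 = \<Sum>\<^sub>i \<bar>\<langle>u, p\<^sub>i\<rangle>\<bar>\<^sup>2\<close>, the vectors \<open>f\<^sub>i = (L\<^sup>-\<^sup>1)\<^sup>* p\<^sub>i\<close> do the job: the layers of the energy of \<open>L v\<close>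
  are \<open>\<parallel>T\<^sup>n v\<parallel>\<^sup>2 - \<parallel>T\<^bsup>n+1\<^esup> v\<parallel>\<^sup>2\<close>, and they telescope to \<open>\<parallel>v\<parallel>\<^sup>2\<close> (\<open>frame_if_similar_to_stable_contraction\<close>).
  The usual choice \<open>p\<^sub>i = (I - T\<^sup>* T)\<^bsup>1/2\<^esup> e\<^sub>i\<close> for an orthonormal basis \<open>(e\<^sub>i)\<close> needs the square root of an
  operator that may fail to be invertible. Here the \<open>p\<^sub>i\<close> come instead from a Cholesky
  decomposition of the positive operator \<open>I - T\<^sup>* T\<close>, with pivots taken from a dense sequence
  (\<open>positive_op_rank_one_series\<close>) or, if the range is finite-dimensional, from finitely many preimages of vectors
  spanning it (\<open>positive_op_rank_one_sum\<close>).

  So a square root is needed only for the frame operator, which is coercive: its quadratic form is bounded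
  below by a positive multiple of \<open>\<parallel>h\<parallel>\<^sup>2\<close>. Then inverse and square root are both fixed points
  of contractions (\<open>coercive_op_bij\<close>, \<open>coercive_op_sqrt_exists\<close>).
\<close>

section \<open>Hilbert space geometry\<close>

lemma scaleC_eq_scaleR: "x *\<^sub>R y = complex_of_real x *\<^sub>C (y::'a::complex_vector)"
  by (simp add: scaleC_of_real)

lemma cinner_add_right: "cinner x (y + z) = cinner x y + cinner x (z::'a::complex_inner)"
  by (metis cinner_add_left cinner_commute complex_cnj_add)

lemma cinner_scaleC_right: "cinner x (a *\<^sub>C y) = cnj a * cinner x (y::'a::complex_inner)"
  by (metis cinner_commute cinner_scaleC_left complex_cnj_mult)

lemma cinner_scaleR_left: "cinner (r *\<^sub>R x) y = of_real r * cinner x (y::'a::complex_inner)"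
  by (simp add: scaleC_eq_scaleR cinner_scaleC_left)

lemma cinner_scaleR_right: "cinner x (r *\<^sub>R y) = of_real r * cinner x (y::'a::complex_inner)"
  by (simp add: scaleC_eq_scaleR cinner_scaleC_right)

lemma cinner_zero_left [simp]: "cinner 0 (y::'a::complex_inner) = 0"
  using cinner_add_left[of 0 0 y] by simp

lemma cinner_zero_right [simp]: "cinner (y::'a::complex_inner) 0 = 0"
  using cinner_add_right[of y 0 0] by simp

lemma cinner_minus_left: "cinner (- x) y = - cinner x (y::'a::complex_inner)"
  using cinner_add_left[of x "-x" y] by (simp add: add_eq_0_iff)

lemma cinner_minus_right: "cinner x (- y) = - cinner x (y::'a::complex_inner)"
  using cinner_add_right[of x y "-y"] by (simp add: add_eq_0_iff)

lemma cinner_diff_left: "cinner (x - y) z = cinner x z - cinner y (z::'a::complex_inner)"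
  using cinner_add_left[of x "-y" z] by (simp add: cinner_minus_left)

lemma cinner_diff_right: "cinner x (y - z) = cinner x y - cinner x (z::'a::complex_inner)"
  using cinner_add_right[of x y "-z"] by (simp add: cinner_minus_right)

lemmas cinner_simps = cinner_add_left cinner_add_right cinner_diff_left cinner_diff_right
  cinner_scaleC_left cinner_scaleC_right cinner_scaleR_left cinner_scaleR_right
  cinner_minus_left cinner_minus_right

lemma cinner_sum_left: "cinner (\<Sum>k\<in>F. f k) (y::'a::complex_inner) = (\<Sum>k\<in>F. cinner (f k) y)"
  by (induction F rule: infinite_finite_induct) (auto simp: cinner_add_left)

lemma cinner_self: "cinner x (x::'a::complex_inner) = complex_of_real ((norm x)\<^sup>2)"
proof -
  have "Im (cinner x x) = 0"
    using cinner_commute[of x x] by (metis cnj.simps(2) neg_equal_zero)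
  then show ?thesis
    using cinner_ge_zero[of x] by (simp add: norm_eq_sqrt_cinner complex_eq_iff)
qed

lemma cinner_right_eqI:
  assumes "\<And>x. cinner x y = cinner x (z::'a::complex_inner)"
  shows "y = z"
proof -
  have "cinner (y - z) (y - z) = 0"
    using assms[of "y - z"] by (simp add: cinner_diff_right)
  then show ?thesis by (simp add: cinner_eq_zero_iff)
qed

lemma cinner_left_eqI:
  assumes "\<And>x. cinner y x = cinner (z::'a::complex_inner) x"
  shows "y = z"
  by (rule cinner_right_eqI) (metis assms cinner_commute)

lemma norm_add_sqr: "(norm (x + y :: 'a::complex_inner))\<^sup>2 = (norm x)\<^sup>2 + 2 * Re (cinner x y) + (norm y)\<^sup>2"
proof -
  have "cinner y x = cnj (cinner x y)" by (rule cinner_commute)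
  then have "Re (cinner (x + y) (x + y)) = Re (cinner x x) + 2 * Re (cinner x y) + Re (cinner y y)"
    by (simp add: cinner_simps)
  then show ?thesis by (simp add: cinner_self)
qed

lemma parallelogram:
  "(norm (x + y :: 'a::complex_inner))\<^sup>2 + (norm (x - y))\<^sup>2 = 2 * (norm x)\<^sup>2 + 2 * (norm y)\<^sup>2"
  using norm_add_sqr[of x y] norm_add_sqr[of x "-y"] by (simp add: cinner_minus_right)

lemma norm_scaleC: "norm (c *\<^sub>C x) = cmod c * norm (x::'a::complex_inner)"
proof -
  have "complex_of_real ((norm (c *\<^sub>C x))\<^sup>2) = c * cnj c * complex_of_real ((norm x)\<^sup>2)"
    unfolding cinner_self[symmetric] by (simp add: cinner_simps)
  also have "\<dots> = complex_of_real ((cmod c * norm x)\<^sup>2)"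
    using complex_norm_square[of c] by (simp add: power_mult_distrib)
  finally have "(norm (c *\<^sub>C x))\<^sup>2 = (cmod c * norm x)\<^sup>2" using of_real_eq_iff by blast
  then show ?thesis by simp
qed

text \<open>Linearity is kept apart from boundedness, because norm bounds will be deduced from bounds on
  quadratic forms.\<close>

definition clinear_op :: "('a::complex_vector \<Rightarrow> 'b::complex_vector) \<Rightarrow> bool" where
  "clinear_op Q \<longleftrightarrow> (\<forall>x y. Q (x + y) = Q x + Q y) \<and> (\<forall>c x. Q (c *\<^sub>C x) = c *\<^sub>C Q x)"

lemma clinear_op_add: "clinear_op Q \<Longrightarrow> Q (x + y) = Q x + Q y"
  and clinear_op_scaleC: "clinear_op Q \<Longrightarrow> Q (c *\<^sub>C x) = c *\<^sub>C Q x"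
  by (auto simp: clinear_op_def)

lemma clinear_op_diff: "clinear_op Q \<Longrightarrow> Q (x - y) = Q x - Q y"
  by (metis clinear_op_add diff_add_cancel add_diff_cancel_right')

lemma clinear_op_zero: "clinear_op Q \<Longrightarrow> Q 0 = 0"
  by (metis clinear_op_diff diff_self)

lemma clinear_op_id: "clinear_op (\<lambda>x. x)"
  by (simp add: clinear_op_def)

text \<open>Over the complex scalars a quadratic form that takes only real values comes from a symmetric
  sesquilinear form: evaluate it at \<open>x + y\<close> and at \<open>x + \<i> y\<close>.\<close>

lemma hermitian_if_real_form:
  fixes Q :: "'a::complex_inner \<Rightarrow> 'a"
  assumes Q: "clinear_op Q" and real: "\<And>x. cinner (Q x) x \<in> \<real>"
  shows "cinner (Q x) y = cinner x (Q y)"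
proof -
  have Im0: "Im (cinner (Q x) x) = 0" for x
    using real[of x] by (simp add: complex_is_Real_iff)
  have "Im (cinner (Q x) y) + Im (cinner (Q y) x) = 0"
    using Im0[of "x + y"] Im0[of x] Im0[of y]
    by (simp add: clinear_op_add[OF Q] cinner_simps)
  moreover have "Re (cinner (Q y) x) - Re (cinner (Q x) y) = 0"
    using Im0[of "x + \<i> *\<^sub>C y"] Im0[of x] Im0[of y]
    by (simp add: clinear_op_add[OF Q] clinear_op_scaleC[OF Q] cinner_simps)
  ultimately have "cinner (Q x) y = cnj (cinner (Q y) x)"
    by (simp add: complex_eq_iff)
  then show ?thesis by (metis cinner_commute)
qed

text \<open>This is polarisation again. It is special to complex scalars: in the real plane a rotation by a
  right angle has the same quadratic form as \<open>0\<close>.\<close>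

lemma operator_eqI_quadratic:
  fixes Q R :: "'a::complex_inner \<Rightarrow> 'a"
  assumes Q: "clinear_op Q" and R: "clinear_op R" and eq: "\<And>x. cinner (Q x) x = cinner (R x) x"
  shows "Q x = R x"
proof (rule cinner_left_eqI)
  fix y
  define D where "D = (\<lambda>x. Q x - R x)"
  have D: "clinear_op D"
    using Q R by (auto simp: D_def clinear_op_def complex_vector.scale_right_diff_distrib)
  have D0: "cinner (D x) x = 0" for x
    using eq by (simp add: D_def cinner_diff_left)
  have "cinner (D x) y + cinner (D y) x = 0"
    using D0[of "x + y"] D0[of x] D0[of y]
    by (simp add: clinear_op_add[OF D] cinner_simps add.commute)
  moreover have "\<i> * cinner (D y) x - \<i> * cinner (D x) y = 0"
    using D0[of "x + \<i> *\<^sub>C y"] D0[of x] D0[of y]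
    by (simp add: clinear_op_add[OF D] clinear_op_scaleC[OF D] cinner_simps)
  ultimately have "cinner (D x) y = 0"
    by (simp add: algebra_simps)
  then show "cinner (Q x) y = cinner (R x) y" by (simp add: D_def cinner_diff_left)
qed

text \<open>Evaluate the form at \<open>t x - w y\<close> with \<open>w = \<langle>Q x, y\<rangle>\<close> and \<open>t\<close> real. The form may be degenerate, so
  \<open>\<langle>Q x, x\<rangle> > 0\<close> is first deduced from \<open>w \<noteq> 0\<close>; only then the minimising \<open>t\<close> can be inserted.\<close>

lemma Cauchy_Schwarz_form:
  fixes Q :: "'a::complex_inner \<Rightarrow> 'a"
  assumes Q: "clinear_op Q" and real: "\<And>x. cinner (Q x) x \<in> \<real>"
    and pos: "\<And>x. 0 \<le> Re (cinner (Q x) x)"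
  shows "(cmod (cinner (Q x) y))\<^sup>2 \<le> Re (cinner (Q x) x) * Re (cinner (Q y) y)"
proof -
  define a where "a = Re (cinner (Q x) x)"
  define b where "b = Re (cinner (Q y) y)"
  define w where "w = cinner (Q x) y"
  have w': "cinner (Q y) x = cnj w"
    using hermitian_if_real_form[OF Q real] by (metis w_def cinner_commute)
  have quad: "0 \<le> a * t\<^sup>2 - 2 * (cmod w)\<^sup>2 * t + (cmod w)\<^sup>2 * b" for t :: real
  proof -
    have "cinner (Q (of_real t *\<^sub>C x - w *\<^sub>C y)) (of_real t *\<^sub>C x - w *\<^sub>C y)
        = of_real (t\<^sup>2) * cinner (Q x) x - of_real (2 * t) * (w * cnj w) + (w * cnj w) * cinner (Q y) y"
      by (simp add: clinear_op_diff[OF Q] clinear_op_scaleC[OF Q] cinner_simps w' flip: w_def)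
         (simp add: algebra_simps power2_eq_square)
    also have "w * cnj w = of_real ((cmod w)\<^sup>2)" using complex_norm_square[of w] by simp
    finally have "Re (cinner (Q (of_real t *\<^sub>C x - w *\<^sub>C y)) (of_real t *\<^sub>C x - w *\<^sub>C y))
        = t\<^sup>2 * a - 2 * t * (cmod w)\<^sup>2 + (cmod w)\<^sup>2 * b"
      by (simp add: a_def b_def del: of_real_power)
    then show ?thesis
      using pos[of "of_real t *\<^sub>C x - w *\<^sub>C y"] by (simp add: algebra_simps)
  qed
  show ?thesis
  proof (cases "w = 0")
    case True
    then show ?thesis using pos by (simp flip: w_def)
  next
    case False
    then have W: "(cmod w)\<^sup>2 > 0" by simp
    have a0: "a \<ge> 0" and b0: "b \<ge> 0" using pos by (auto simp: a_def b_def)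
    have "a > 0"
    proof (rule ccontr)
      assume "\<not> a > 0"
      \<comment> \<open>for \<open>a = 0\<close> the quadratic is affine and decreasing in \<open>t\<close>, and negative at \<open>t = b + 1\<close>\<close>
      then have "a = 0" using a0 by simp
      then have "0 \<le> (cmod w)\<^sup>2 * (b - 2 * (b + 1))"
        using quad[of "b + 1"] by (simp add: algebra_simps)
      then show False using W b0 by (simp add: zero_le_mult_iff)
    qed
    then have "0 \<le> (cmod w)\<^sup>2 * (b - (cmod w)\<^sup>2 / a)"
      using quad[of "(cmod w)\<^sup>2 / a"] by (simp add: field_simps power2_eq_square)
    then have "(cmod w)\<^sup>2 / a \<le> b" using W by (simp add: zero_le_mult_iff)
    then show ?thesis using \<open>a > 0\<close> by (simp add: field_simps a_def b_def w_def)
  qed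
qed

lemma Cauchy_Schwarz: "cmod (cinner x y) \<le> norm x * norm (y::'a::complex_inner)"
proof -
  have "(cmod (cinner x y))\<^sup>2 \<le> (norm x * norm y)\<^sup>2"
    using Cauchy_Schwarz_form[of "\<lambda>x::'a. x" x y]
    by (simp add: clinear_op_id cinner_self power_mult_distrib flip: of_real_power)
  then show ?thesis by (rule power2_le_imp_le) simp
qed

lemma bounded_linear_cinner_left: "bounded_linear (\<lambda>x. cinner x (y::'a::complex_inner))"
  by (rule bounded_linear_intro[where K = "norm y"])
     (simp_all add: cinner_simps scaleR_conv_of_real Cauchy_Schwarz)

lemma bounded_linear_cinner_right: "bounded_linear (\<lambda>y. cinner (x::'a::complex_inner) y)"
  by (rule bounded_linear_intro[where K = "norm x"])
     (simp_all add: cinner_simps scaleR_conv_of_real Cauchy_Schwarz mult.commute[of _ "norm x"])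

lemma bounded_linear_scaleC_right: "bounded_linear (\<lambda>x::'a::complex_inner. c *\<^sub>C x)"
  by (rule bounded_linear_intro[where K = "cmod c"])
     (simp_all add: scaleC_add_right scaleC_eq_scaleR complex_vector.scale_left_commute norm_scaleC mult.commute)

section \<open>Riesz representation and adjoints\<close>

instance complex_hilbert \<subseteq> banach ..

text \<open>The representing vector minimises \<open>J x = \<parallel>x\<parallel>\<^sup>2 - 2 Re (\<phi> x)\<close>. By the parallelogram law a minimising
  sequence is Cauchy, and the first variation of \<open>J\<close> at its limit is the desired identity.\<close>

lemma Riesz_representation:
  fixes \<phi> :: "'a::complex_hilbert \<Rightarrow> complex"
  assumes \<phi>: "bounded_linear \<phi>" and hom: "\<And>c x. \<phi> (c *\<^sub>C x) = c * \<phi> x"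
  shows "\<exists>y. \<forall>x. \<phi> x = cinner x y"
proof -
  interpret \<phi>: bounded_linear \<phi> by fact
  obtain M where M: "\<And>x. cmod (\<phi> x) \<le> norm x * M" "M \<ge> 0" using \<phi>.nonneg_bounded by blast
  define J where "J = (\<lambda>x. (norm x)\<^sup>2 - 2 * Re (\<phi> x))"
  have J_lower: "- M\<^sup>2 \<le> J x" for x
  proof -
    have "Re (\<phi> x) \<le> norm x * M" using M(1)[of x] complex_Re_le_cmod order_trans by blast
    moreover have "0 \<le> (norm x - M)\<^sup>2" by simp
    ultimately show ?thesis by (simp add: J_def power2_eq_square algebra_simps)
  qed
  define m where "m = Inf (range J)"
  have bdd: "bdd_below (range J)" using J_lower by (intro bdd_belowI) auto
  have m_le: "m \<le> J x" for x unfolding m_def by (rule cInf_lower[OF _ bdd]) auto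
  have gap: "(norm (x - y))\<^sup>2 \<le> 2 * (J x - m) + 2 * (J y - m)" for x y
  proof -
    have "4 * J ((1/2) *\<^sub>R (x + y)) = (norm (x + y))\<^sup>2 - 4 * (Re (\<phi> x) + Re (\<phi> y))"
      by (simp add: J_def \<phi>.add \<phi>.scaleR power_mult_distrib power2_eq_square) (simp add: algebra_simps)
    then show ?thesis
      using m_le[of "(1/2) *\<^sub>R (x + y)"] parallelogram[of x y] by (simp add: J_def)
  qed
  have "\<exists>x. J x < m + 1 / Suc n" for n :: nat
    using cInf_lessD[of "range J" "m + 1 / Suc n"] by (auto simp: m_def)
  then obtain x where x: "\<And>n::nat. J (x n) < m + 1 / Suc n" by metis
  have "Cauchy x"
  proof (rule metric_CauchyI)
    fix e :: real assume e: "e > 0"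
    then obtain N where N: "inverse (of_nat (Suc N)) < e\<^sup>2 / 4"
      using reals_Archimedean[of "e\<^sup>2 / 4"] by auto
    have small: "J (x n) - m < e\<^sup>2 / 4" if "n \<ge> N" for n
    proof -
      have "1 / real (Suc n) \<le> inverse (of_nat (Suc N))"
        using that by (simp add: field_simps)
      then show ?thesis using x[of n] N by linarith
    qed
    have "dist (x i) (x j) < e" if "i \<ge> N" "j \<ge> N" for i j
    proof -
      have "(norm (x i - x j))\<^sup>2 < e\<^sup>2"
        using gap[of "x i" "x j"] small[OF that(1)] small[OF that(2)] by argo
      then show ?thesis using e by (simp add: dist_norm power_less_imp_less_base)
    qed
    then show "\<exists>M. \<forall>i\<ge>M. \<forall>j\<ge>M. dist (x i) (x j) < e" by blast
  qed
  then obtain y where y: "x \<longlonglongrightarrow> y" by (auto simp: Cauchy_convergent_iff convergent_def)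
  have "(\<lambda>n. J (x n)) \<longlonglongrightarrow> J y"
    unfolding J_def by (intro tendsto_intros y \<phi>.tendsto)
  moreover have "(\<lambda>n. m + 1 / Suc n) \<longlonglongrightarrow> m + 0"
    by (intro tendsto_intros LIMSEQ_Suc[OF lim_1_over_n])
  ultimately have "J y \<le> m + 0"
    by (rule LIMSEQ_le) (use x less_imp_le in blast)
  then have Jy: "J y \<le> J z" for z using m_le[of z] by linarith
  have re: "Re (\<phi> z) = Re (cinner z y)" for z
  proof -
    define b where "b = Re (cinner y z) - Re (\<phi> z)"
    have q: "0 \<le> 2 * t * b + t\<^sup>2 * (norm z)\<^sup>2" for t :: real
      using Jy[of "y + t *\<^sub>R z"]
      by (simp add: J_def norm_add_sqr \<phi>.add \<phi>.scaleR cinner_simps b_def power_mult_distrib algebra_simps)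
    have "b = 0"
    proof (cases "norm z = 0")
      case True
      then show ?thesis using q[of "- b"] by (simp add: power2_eq_square mult_le_0_iff, linarith)
    next
      case False
      \<comment> \<open>insert the minimiser of the quadratic in \<open>q\<close>\<close>
      then have "0 \<le> - (b\<^sup>2 / (norm z)\<^sup>2)"
        using q[of "- b / (norm z)\<^sup>2"] by (simp add: field_simps power2_eq_square)
      then show ?thesis using False by (simp add: divide_le_0_iff)
    qed
    then show ?thesis using cinner_commute[of z y] by (simp add: b_def)
  qed
  have "\<phi> z = cinner z y" for z
    using re[of z] re[of "\<i> *\<^sub>C z"] by (simp add: hom cinner_simps complex_eq_iff)
  then show ?thesis by blast
qed

lemma bounded_clinear_imp_clinear_op: "bounded_clinear T \<Longrightarrow> clinear_op T"
  by (auto simp: bounded_clinear_def clinear_op_def linear_simps)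

lemma bounded_clinear_imp_bounded_linear: "bounded_clinear T \<Longrightarrow> bounded_linear T"
  by (simp add: bounded_clinear_def)

lemma bounded_clinearI:
  assumes "clinear_op T" and "\<And>x. norm (T x) \<le> K * norm x"
  shows "bounded_clinear T"
  unfolding bounded_clinear_def
  using assms by (auto simp: clinear_op_def scaleC_eq_scaleR mult.commute intro!: bounded_linear_intro[where K = K])

lemma bounded_clinear_compose:
  "bounded_clinear S \<Longrightarrow> bounded_clinear T \<Longrightarrow> bounded_clinear (\<lambda>x. S (T x))"
  unfolding bounded_clinear_def by (auto intro: bounded_linear_compose)

lemma bounded_clinear_diff:
  "bounded_clinear S \<Longrightarrow> bounded_clinear T \<Longrightarrow> bounded_clinear (\<lambda>x. S x - T x)"
  unfolding bounded_clinear_def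
  by (auto intro: bounded_linear_sub simp: complex_vector.scale_right_diff_distrib)

lemma bounded_clinear_id: "bounded_clinear (\<lambda>x. x)"
  by (simp add: bounded_clinear_def bounded_linear_ident)

lemma cadjoint_works:
  fixes T :: "'a::complex_hilbert \<Rightarrow> 'b::complex_inner"
  assumes T: "bounded_clinear T"
  shows "cinner (T x) y = cinner x (cadjoint T y)"
proof -
  have "\<exists>z. \<forall>x. cinner (T x) y = cinner x z" for y
  proof (rule Riesz_representation)
    show "bounded_linear (\<lambda>x. cinner (T x) y)"
      by (rule bounded_linear_compose[OF bounded_linear_cinner_left])
         (use T in \<open>simp add: bounded_clinear_def\<close>)
    show "\<And>c x. cinner (T (c *\<^sub>C x)) y = c * cinner (T x) y"
      using T by (simp add: bounded_clinear_def cinner_simps)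
  qed
  then have "\<exists>T'. \<forall>x y. cinner (T x) y = cinner x (T' y)" by metis
  then have "\<forall>x y. cinner (T x) y = cinner x (cadjoint T y)"
    unfolding cadjoint_def by (rule someI_ex)
  then show ?thesis by blast
qed

lemma cadjoint_works':
  fixes T :: "'a::complex_hilbert \<Rightarrow> 'b::complex_inner"
  assumes T: "bounded_clinear T"
  shows "cinner (cadjoint T x) y = cinner x (T y)"
  by (metis cadjoint_works[OF T] cinner_commute)

lemma bounded_clinear_cadjoint:
  fixes T :: "'a::complex_hilbert \<Rightarrow> 'b::complex_inner"
  assumes T: "bounded_clinear T"
  shows "bounded_clinear (cadjoint T)"
proof -
  note [simp] = cadjoint_works'[OF T]
  obtain K where K: "K \<ge> 0" "\<And>x. norm (T x) \<le> norm x * K"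
    using bounded_linear.nonneg_bounded[OF bounded_clinear_imp_bounded_linear[OF T]] by blast
  have "norm (cadjoint T y) \<le> K * norm y" for y
  proof (cases "cadjoint T y = 0")
    case False
    let ?z = "cadjoint T y"
    have "complex_of_real ((norm ?z)\<^sup>2) = cinner y (T ?z)" unfolding cinner_self[symmetric] by simp
    then have "(norm ?z)\<^sup>2 = cmod (cinner y (T ?z))"
      by (metis norm_of_real abs_of_nonneg zero_le_power2)
    also have "\<dots> \<le> norm y * (norm ?z * K)"
      by (meson Cauchy_Schwarz K(2) mult_left_mono norm_ge_zero order_trans)
    finally have "norm ?z * norm ?z \<le> norm ?z * (K * norm y)"
      by (simp add: power2_eq_square mult_ac)
    then show ?thesis using False by simp
  qed (use K in simp)
  moreover have "clinear_op (cadjoint T)"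
    unfolding clinear_op_def
    by (intro conjI allI; rule cinner_left_eqI) (simp_all add: cinner_add_left cinner_scaleC_left)
  ultimately show ?thesis by (rule bounded_clinearI[rotated])
qed

section \<open>Positive operators and their square roots\<close>

text \<open>Apply the Cauchy--Schwarz inequality of the form to the pair \<open>x\<close>, \<open>Q x\<close>.\<close>

lemma norm_le_if_form_le:
  fixes Q :: "'a::complex_inner \<Rightarrow> 'a"
  assumes Q: "clinear_op Q" and real: "\<And>x. cinner (Q x) x \<in> \<real>"
    and pos: "\<And>x. 0 \<le> Re (cinner (Q x) x)" and le: "\<And>x. Re (cinner (Q x) x) \<le> c * (norm x)\<^sup>2"
  shows "norm (Q x) \<le> c * norm x"
proof (cases "Q x = 0 \<or> x = 0")
  case True
  have "0 \<le> c * norm x"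
  proof (cases "x = 0")
    case False
    have "0 \<le> c * (norm x)\<^sup>2" using pos[of x] le[of x] by linarith
    then show ?thesis using False by (simp add: zero_le_mult_iff)
  qed simp
  then show ?thesis using True clinear_op_zero[OF Q] by auto
next
  case False
  define n where "n = (norm (Q x))\<^sup>2"
  have n: "n > 0" using False by (simp add: n_def)
  have "0 \<le> c * (norm x)\<^sup>2" using pos[of x] le[of x] by linarith
  then have c: "c \<ge> 0" using False by (simp add: zero_le_mult_iff)
  have "n\<^sup>2 = (cmod (cinner (Q x) (Q x)))\<^sup>2" by (simp add: cinner_self n_def norm_power)
  also have "\<dots> \<le> Re (cinner (Q x) x) * Re (cinner (Q (Q x)) (Q x))"
    by (rule Cauchy_Schwarz_form[OF Q real pos])
  also have "\<dots> \<le> (c * (norm x)\<^sup>2) * (c * n)"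
    unfolding n_def by (intro mult_mono le pos) (use c in auto)
  finally have "n * n \<le> n * (c * norm x)\<^sup>2"
    by (simp add: power2_eq_square mult_ac)
  then have "n \<le> (c * norm x)\<^sup>2" using n by (simp only: mult_le_cancel_left_pos)
  then have "(norm (Q x))\<^sup>2 \<le> (c * norm x)\<^sup>2" by (simp add: n_def)
  then show ?thesis by (rule power2_le_imp_le) (use c in simp)
qed

lemma positive_opI:
  fixes Q :: "'a::complex_inner \<Rightarrow> 'a"
  assumes "clinear_op Q" and "\<And>x. cinner (Q x) x \<in> \<real>"
    and "\<And>x. 0 \<le> Re (cinner (Q x) x)" and "\<And>x. Re (cinner (Q x) x) \<le> c * (norm x)\<^sup>2"
  shows "positive_op Q"
  unfolding positive_op_def
  using bounded_clinearI[OF assms(1) norm_le_if_form_le[OF assms]] assms by blast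

context
  fixes Q :: "'a::complex_inner \<Rightarrow> 'a"
  assumes Q: "positive_op Q"
begin

lemma positive_op_bounded_clinear: "bounded_clinear Q"
  and positive_op_real: "cinner (Q x) x \<in> \<real>"
  and positive_op_nonneg: "0 \<le> Re (cinner (Q x) x)"
  using Q by (auto simp: positive_op_def)

lemma positive_op_clinear: "clinear_op Q"
  by (rule bounded_clinear_imp_clinear_op[OF positive_op_bounded_clinear])

lemma positive_op_hermitian: "cinner (Q x) y = cinner x (Q y)"
  by (rule hermitian_if_real_form[OF positive_op_clinear positive_op_real])

lemma positive_op_Cauchy_Schwarz:
  "(cmod (cinner (Q x) y))\<^sup>2 \<le> Re (cinner (Q x) x) * Re (cinner (Q y) y)"
  by (rule Cauchy_Schwarz_form[OF positive_op_clinear positive_op_real positive_op_nonneg])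

end

definition coercive_op :: "('a::complex_inner \<Rightarrow> 'a) \<Rightarrow> bool" where
  "coercive_op Q \<longleftrightarrow> positive_op Q \<and> (\<exists>\<delta>>0. \<forall>x. \<delta> * (norm x)\<^sup>2 \<le> Re (cinner (Q x) x))"

lemma coercive_imp_positive_op: "coercive_op Q \<Longrightarrow> positive_op Q"
  by (simp add: coercive_op_def)

text \<open>After rescaling, a coercive operator is a perturbation of the identity of norm less than one;
  this makes the contraction principle available both for inverting it and for extracting roots.\<close>

lemma coercive_op_near_identity:
  fixes Q :: "'a::complex_inner \<Rightarrow> 'a"
  assumes "coercive_op Q"
  obtains b q where "b > 0" "0 \<le> q" "q < 1" "\<And>x. norm (x - (1 / b) *\<^sub>R Q x) \<le> q * norm x"
proof -
  have Q: "positive_op Q" using assms by (rule coercive_imp_positive_op)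
  obtain \<delta> where \<delta>: "\<delta> > 0" "\<And>x. \<delta> * (norm x)\<^sup>2 \<le> Re (cinner (Q x) x)"
    using assms by (auto simp: coercive_op_def)
  obtain K where K: "K > 0" "\<And>x. norm (Q x) \<le> norm x * K"
    using bounded_linear.pos_bounded positive_op_bounded_clinear[OF Q] bounded_clinear_imp_bounded_linear
    by blast
  \<comment> \<open>\<open>K \<le> b\<close> makes \<open>I - Q / b\<close> positive. On the zero space \<open>\<delta>\<close> may exceed \<open>K\<close>, and \<open>\<delta> \<le> b\<close> secures \<open>q \<ge> 0\<close>.\<close>
  define b where "b = max K \<delta>"
  define q where "q = 1 - \<delta> / b"
  have b: "b > 0" "K \<le> b" "\<delta> \<le> b" using K by (auto simp: b_def)
  have q: "0 \<le> q" "q < 1" using b \<delta> by (auto simp: q_def field_simps)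
  define X where "X = (\<lambda>x. x - (1 / b) *\<^sub>R Q x)"
  have X: "clinear_op X"
    unfolding X_def clinear_op_def
    by (simp add: scaleC_eq_scaleR complex_vector.scale_right_diff_distrib complex_vector.scale_left_commute
        clinear_op_add[OF positive_op_clinear[OF Q]] clinear_op_scaleC[OF positive_op_clinear[OF Q]]
        complex_vector.scale_right_distrib)
  have form: "cinner (X x) x = of_real ((norm x)\<^sup>2) - of_real (1 / b) * cinner (Q x) x" for x
    by (simp add: X_def cinner_diff_left cinner_scaleR_left cinner_self)
  have upper: "Re (cinner (Q x) x) \<le> b * (norm x)\<^sup>2" for x
  proof -
    have "Re (cinner (Q x) x) \<le> norm (Q x) * norm x"
      using Cauchy_Schwarz complex_Re_le_cmod order_trans by blast
    also have "\<dots> \<le> norm x * b * norm x"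
      using K(2)[of x] b(2) by (meson mult_left_mono mult_right_mono norm_ge_zero order_trans)
    finally show ?thesis by (simp add: power2_eq_square mult_ac)
  qed
  have "norm (X x) \<le> q * norm x" for x
  proof (rule norm_le_if_form_le[OF X])
    fix x
    show "cinner (X x) x \<in> \<real>"
      unfolding form using positive_op_real[OF Q] by (auto intro!: Reals_diff Reals_mult simp del: of_real_divide of_real_power)
    show "0 \<le> Re (cinner (X x) x)"
      unfolding form using upper[of x] b by (simp add: field_simps del: of_real_power of_real_divide)
    show "Re (cinner (X x) x) \<le> q * (norm x)\<^sup>2"
      unfolding form using \<delta>(2)[of x] b by (simp add: field_simps q_def del: of_real_power of_real_divide)
  qed
  then show thesis using that b(1) q by (simp add: X_def)
qed

lemma coercive_op_lower_bound:
  assumes "\<delta> > 0" "\<And>x. \<delta> * (norm x)\<^sup>2 \<le> Re (cinner (Q x) (x::'a::complex_inner))"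
  shows "\<delta> * norm x \<le> norm (Q x)"
proof (cases "x = 0")
  case False
  have "\<delta> * norm x * norm x \<le> norm (Q x) * norm x"
    using assms(2)[of x] Cauchy_Schwarz[of "Q x" x] complex_Re_le_cmod[of "cinner (Q x) x"]
    by (simp add: power2_eq_square)
  then show ?thesis using False by simp
qed simp

lemma coercive_op_bij:
  fixes Q :: "'a::complex_hilbert \<Rightarrow> 'a"
  assumes "coercive_op Q"
  shows "bij Q" and "bounded_clinear (inv Q)"
proof -
  have Q: "positive_op Q" using assms by (rule coercive_imp_positive_op)
  note lin = positive_op_clinear[OF Q]
  obtain \<delta> where \<delta>: "\<delta> > 0" "\<And>x. \<delta> * (norm x)\<^sup>2 \<le> Re (cinner (Q x) x)"
    using assms by (auto simp: coercive_op_def)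
  note lower = coercive_op_lower_bound[OF \<delta>]
  have inj: "inj Q"
  proof (rule injI)
    fix x y assume "Q x = Q y"
    then have "\<delta> * norm (x - y) \<le> 0" using lower[of "x - y"] by (simp add: clinear_op_diff[OF lin])
    then show "x = y" using \<delta>(1) by (simp add: mult_le_0_iff)
  qed
  obtain b q where b: "b > 0" and q: "0 \<le> q" "q < 1"
    and near: "\<And>x. norm (x - (1 / b) *\<^sub>R Q x) \<le> q * norm x"
    by (rule coercive_op_near_identity[OF assms]) blast
  have surj: "\<exists>x. Q x = y" for y
  proof -
    \<comment> \<open>a fixed point of this Richardson iteration solves \<open>Q x = y\<close>\<close>
    define f where "f = (\<lambda>x. (1 / b) *\<^sub>R y + (x - (1 / b) *\<^sub>R Q x))"
    have "\<exists>!x. f x = x"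
    proof (rule banach_fix_type[OF q], intro allI)
      fix x z
      have "f x - f z = (x - z) - (1 / b) *\<^sub>R Q (x - z)"
        by (simp add: f_def clinear_op_diff[OF lin] scaleR_diff_right)
      then show "dist (f x) (f z) \<le> q * dist x z"
        using near[of "x - z"] by (simp add: dist_norm)
    qed
    then obtain x where "f x = x" by blast
    then have "(1 / b) *\<^sub>R (y - Q x) = 0" by (simp add: f_def algebra_simps)
    then show ?thesis using b by auto
  qed
  show bij: "bij Q" using inj surj by (metis bijI surjI)
  have QI: "Q (inv Q y) = y" for y using bij by (simp add: bij_is_surj surj_f_inv_f)
  show "bounded_clinear (inv Q)"
  proof (rule bounded_clinearI[where K = "1 / \<delta>"])
    show "clinear_op (inv Q)" unfolding clinear_op_def
      by (intro conjI allI; rule injD[OF inj]) (simp_all add: QI clinear_op_add[OF lin] clinear_op_scaleC[OF lin])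
    show "norm (inv Q y) \<le> 1 / \<delta> * norm y" for y
      using lower[of "inv Q y"] \<delta>(1) by (simp add: QI field_simps)
  qed
qed

text \<open>Write \<open>Q = b (I - X)\<close> with \<open>\<parallel>X\<parallel> \<le> q < 1\<close>. The solution of \<open>(I - Y)\<^sup>2 = I - X\<close> is the fixed point of
  \<open>Y \<mapsto> (X + Y\<^sup>2) / 2\<close>, which is a \<open>q\<close>-contraction of the ball of radius \<open>q\<close> in the operator norm. The
  complex-linear Hermitian operators in this ball that commute with everything commuting with \<open>Q\<close> form a
  closed invariant set, so \<open>Y\<close> is among them. The commutation property serves to prove uniqueness of the root.\<close>

lemma coercive_op_sqrt_exists:
  fixes Q :: "'a::complex_hilbert \<Rightarrow> 'a"
  assumes "coercive_op Q"
  shows "\<exists>R. coercive_op R \<and> R \<circ> R = Q \<and>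
    (\<forall>C. bounded_linear C \<longrightarrow> (\<forall>x. C (Q x) = Q (C x)) \<longrightarrow> (\<forall>x. C (R x) = R (C x)))"
proof -
  have Q: "positive_op Q" using assms by (rule coercive_imp_positive_op)
  note lin = positive_op_clinear[OF Q]
  have Qbl: "bounded_linear Q" using positive_op_bounded_clinear[OF Q] by (rule bounded_clinear_imp_bounded_linear)
  obtain b q where b: "b > 0" and q: "0 \<le> q" "q < 1"
    and near: "\<And>x. norm (x - (1 / b) *\<^sub>R Q x) \<le> q * norm x"
    by (rule coercive_op_near_identity[OF assms]) blast
  define X where "X = Blinfun (\<lambda>x. x - (1 / b) *\<^sub>R Q x)"
  have X: "blinfun_apply X x = x - (1 / b) *\<^sub>R Q x" for x
    unfolding X_def
    by (subst bounded_linear_Blinfun_apply)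
      (auto intro!: bounded_linear_sub bounded_linear_ident bounded_linear_scaleR_right
        bounded_linear_compose[OF bounded_linear_scaleR_right Qbl])
  have normX: "norm X \<le> q"
    by (rule norm_blinfun_bound) (use near q in \<open>auto simp: X\<close>)
  define comm where "comm = {C::'a \<Rightarrow>\<^sub>L 'a. \<forall>x. C (Q x) = Q (C x)}"
  define \<Y> where "\<Y> = {Y::'a \<Rightarrow>\<^sub>L 'a. norm Y \<le> q \<and> 
    (\<forall>c x. blinfun_apply Y (c *\<^sub>C x) = c *\<^sub>C blinfun_apply Y x) \<and>
    (\<forall>x y. cinner (blinfun_apply Y x) y = cinner x (blinfun_apply Y y)) \<and>
    (\<forall>C. C \<in> comm \<longrightarrow> (\<forall>x. blinfun_apply C (blinfun_apply Y x) = blinfun_apply Y (blinfun_apply C x)))}"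
  have "closed \<Y>"
    unfolding \<Y>_def
    by (intro closed_Collect_conj closed_Collect_all closed_Collect_le closed_Collect_eq closed_Collect_imp
        open_Collect_const continuous_intros
        bounded_linear.continuous_on[OF bounded_linear_cinner_left]
        bounded_linear.continuous_on[OF bounded_linear_cinner_right]
        bounded_linear.continuous_on[OF bounded_linear_scaleC_right])
  define F where "F = (\<lambda>Y. (1 / 2) *\<^sub>R (X + (Y o\<^sub>L Y)))"
  have F: "blinfun_apply (F Y) x = (1 / 2) *\<^sub>R (x - (1 / b) *\<^sub>R Q x + Y (Y x))" for Y x
    by (simp add: F_def blinfun.add_left blinfun.scaleR_left X)
  have "\<exists>!Y\<in>\<Y>. F Y = Y"
  proof (rule Banach_fix[OF _ _ q])
    show "complete \<Y>" using \<open>closed \<Y>\<close> by (simp add: complete_eq_closed)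
    have "0 \<in> \<Y>" using q by (auto simp: \<Y>_def)
    then show "\<Y> \<noteq> {}" by blast
    show "F ` \<Y> \<subseteq> \<Y>"
    proof
      fix Z assume "Z \<in> F ` \<Y>"
      then obtain Y where Z: "Z = F Y" and Y: "norm Y \<le> q" "\<And>c x. blinfun_apply Y (c *\<^sub>C x) = c *\<^sub>C blinfun_apply Y x"
        "\<And>x y. cinner (Y x) y = cinner x (Y y)" "\<And>C x. C \<in> comm \<Longrightarrow> C (Y x) = Y (C x)"
        by (auto simp: \<Y>_def)
      have "norm Y * norm Y \<le> q * 1" by (rule mult_mono) (use Y(1) q in auto)
      then have "norm (Y o\<^sub>L Y) \<le> q" using norm_blinfun_compose[of Y Y] by linarith
      then have "norm (F Y) \<le> q"
        using normX norm_triangle_ineq[of X "Y o\<^sub>L Y"] by (simp add: F_def)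
      moreover have "blinfun_apply (F Y) (c *\<^sub>C x) = c *\<^sub>C blinfun_apply (F Y) x" for c x
        by (simp add: F Y(2) clinear_op_scaleC[OF lin] scaleC_eq_scaleR complex_vector.scale_left_commute
            complex_vector.scale_right_distrib complex_vector.scale_right_diff_distrib)
      moreover have "cinner (F Y x) y = cinner x (F Y y)" for x y
        by (simp add: F cinner_simps Y(3) positive_op_hermitian[OF Q])
      moreover have "C (F Y x) = F Y (C x)" if "C \<in> comm" for C x
        using that by (simp add: F blinfun.bilinear_simps Y(4)) (simp add: comm_def)
      ultimately show "Z \<in> \<Y>" by (simp add: Z \<Y>_def)
    qed
    fix Y Z assume "Y \<in> \<Y>" "Z \<in> \<Y>"
    then have YZ: "norm Y \<le> q" "norm Z \<le> q" by (auto simp: \<Y>_def)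
    have "F Y - F Z = (1 / 2) *\<^sub>R ((Y o\<^sub>L (Y - Z)) + ((Y - Z) o\<^sub>L Z))"
      by (rule blinfun_eqI) (simp add: F blinfun.bilinear_simps scaleR_add_right scaleR_diff_right)
    then have "norm (F Y - F Z) \<le> (1 / 2) * (norm (Y o\<^sub>L (Y - Z)) + norm ((Y - Z) o\<^sub>L Z))"
      using norm_triangle_ineq by simp
    also have "\<dots> \<le> (1 / 2) * (q * norm (Y - Z) + norm (Y - Z) * q)"
      by (intro mult_left_mono add_mono order_trans[OF norm_blinfun_compose] mult_right_mono)
         (use YZ in auto)
    finally show "dist (F Y) (F Z) \<le> q * dist Y Z" by (simp add: dist_norm mult.commute)
  qed
  then obtain Y where "Y \<in> \<Y>" and fixpoint: "F Y = Y" by blast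
  then have Y: "norm Y \<le> q" "\<And>c x. blinfun_apply Y (c *\<^sub>C x) = c *\<^sub>C blinfun_apply Y x"
    "\<And>x y. cinner (Y x) y = cinner x (Y y)" "\<And>C x. C \<in> comm \<Longrightarrow> C (Y x) = Y (C x)"
    by (auto simp: \<Y>_def)
  define R where "R = (\<lambda>x. sqrt b *\<^sub>R (x - Y x))"
  have YY: "Y (Y x) = 2 *\<^sub>R Y x - x + (1 / b) *\<^sub>R Q x" for x
  proof -
    have "2 *\<^sub>R Y x = 2 *\<^sub>R F Y x" by (simp add: fixpoint)
    also have "\<dots> = x - (1 / b) *\<^sub>R Q x + Y (Y x)" by (simp add: F)
    finally show ?thesis by (simp add: algebra_simps)
  qed
  have "R (R x) = Q x" for x
  proof -
    have "R (R x) = b *\<^sub>R (x - Y x - Y (x - Y x))"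
      using b by (simp add: R_def blinfun.bilinear_simps flip: scaleR_diff_right)
    also have "\<dots> = b *\<^sub>R ((1 / b) *\<^sub>R Q x)"
      by (simp add: blinfun.bilinear_simps YY scaleR_2)
    finally show ?thesis using b by simp
  qed
  then have RR: "R \<circ> R = Q" by auto
  have form: "cinner (R x) x = of_real (sqrt b) * (of_real ((norm x)\<^sup>2) - cinner (Y x) x)" for x
    by (simp add: R_def cinner_simps cinner_self)
  have Yle: "cmod (cinner (Y x) x) \<le> q * (norm x)\<^sup>2" for x
  proof -
    have "cmod (cinner (Y x) x) \<le> norm Y * norm x * norm x"
      by (meson Cauchy_Schwarz norm_blinfun mult_right_mono norm_ge_zero order_trans)
    also have "\<dots> \<le> q * norm x * norm x"
      using Y(1) by (intro mult_right_mono) auto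
    finally show ?thesis by (simp add: power2_eq_square)
  qed
  have Rlower: "sqrt b * (1 - q) * (norm x)\<^sup>2 \<le> Re (cinner (R x) x)" for x
  proof -
    have "(1 - q) * (norm x)\<^sup>2 \<le> (norm x)\<^sup>2 - Re (cinner (Y x) x)"
      using Yle[of x] complex_Re_le_cmod[of "cinner (Y x) x"] by (simp add: algebra_simps)
    then show ?thesis using b by (simp add: form mult.assoc del: of_real_power)
  qed
  have Rreal: "cinner (R x) x \<in> \<real>" for x
  proof -
    have "cinner (Y x) x \<in> \<real>" using Y(3)[of x x] cinner_commute[of "Y x" x]
      by (simp add: complex_is_Real_iff) (metis cnj.simps(2) neg_equal_zero)
    then show ?thesis unfolding form by (intro Reals_mult Reals_diff Reals_of_real)
  qed
  have pos: "positive_op R"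
  proof (rule positive_opI[where c = "sqrt b * (1 + q)", OF _ Rreal])
    show "clinear_op R"
      unfolding R_def clinear_op_def
      by (simp add: blinfun.add_right Y(2) mult.commute scaleC_eq_scaleR complex_vector.scale_left_commute
          complex_vector.scale_right_distrib complex_vector.scale_right_diff_distrib)
    show "0 \<le> Re (cinner (R x) x)" for x
      by (rule order_trans[OF _ Rlower]) (use b q in simp)
    show "Re (cinner (R x) x) \<le> sqrt b * (1 + q) * (norm x)\<^sup>2" for x
    proof -
      have "(norm x)\<^sup>2 - Re (cinner (Y x) x) \<le> (1 + q) * (norm x)\<^sup>2"
        using Yle[of x] abs_Re_le_cmod[of "cinner (Y x) x"] by (simp add: algebra_simps)
      then show ?thesis using b by (simp add: form mult.assoc del: of_real_power)
    qed
  qed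
  then have "coercive_op R"
    unfolding coercive_op_def using Rlower b q by (intro conjI exI[of _ "sqrt b * (1 - q)"]) auto
  moreover have "C (R x) = R (C x)" if C: "bounded_linear C" "\<forall>x. C (Q x) = Q (C x)" for C x
  proof -
    have "Blinfun C \<in> comm" using C by (simp add: comm_def bounded_linear_Blinfun_apply)
    then have "C (Y x) = Y (C x)" using Y(4) C(1) by (metis bounded_linear_Blinfun_apply)
    then show ?thesis by (simp add: R_def linear_simps[OF C(1)])
  qed
  ultimately show ?thesis using RR by blast
qed

text \<open>A positive root \<open>P\<close> commutes with \<open>Q = P\<^sup>2\<close>, hence with the coercive root \<open>R\<close>, so that
  \<open>(P + R) (P - R) = P\<^sup>2 - R\<^sup>2 = 0\<close>, where \<open>P + R\<close> is injective.\<close>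

lemma
  fixes Q :: "'a::complex_hilbert \<Rightarrow> 'a"
  assumes "coercive_op Q"
  shows coercive_sqrt_op: "coercive_op (sqrt_op Q)" and sqrt_op_sqrt_op: "sqrt_op Q (sqrt_op Q x) = Q x"
proof -
  obtain R where R: "coercive_op R" "R \<circ> R = Q"
    and comm: "\<And>C x. bounded_linear C \<Longrightarrow> (\<forall>x. C (Q x) = Q (C x)) \<Longrightarrow> C (R x) = R (C x)"
    using coercive_op_sqrt_exists[OF assms] by blast
  have R2: "positive_op R \<and> R \<circ> R = Q" using R by (simp add: coercive_imp_positive_op)
  obtain \<delta> where \<delta>: "\<delta> > 0" "\<And>x. \<delta> * (norm x)\<^sup>2 \<le> Re (cinner (R x) x)"
    using R(1) by (auto simp: coercive_op_def)
  have uniq: "P = R" if P: "positive_op P \<and> P \<circ> P = Q" for P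
  proof
    fix x
    have PP: "P (P x) = Q x" and RR: "R (R x) = Q x" for x
      using P R(2) by (auto simp: fun_eq_iff)
    have linP: "clinear_op P" and linR: "clinear_op R"
      using P R2 by (auto intro: positive_op_clinear)
    have "bounded_linear P" using P bounded_clinear_imp_bounded_linear positive_op_bounded_clinear by blast
    then have "P (R x) = R (P x)" by (rule comm) (metis PP)
    then have zero: "P (P x - R x) + R (P x - R x) = 0"
      by (simp add: clinear_op_diff[OF linP] clinear_op_diff[OF linR] PP RR)
    define z where "z = P x - R x"
    have "Re (cinner (P z) z) + Re (cinner (R z) z) = 0"
      using zero by (simp add: z_def flip: plus_complex.simps(1) cinner_add_left)
    moreover have "0 \<le> Re (cinner (P z) z)" using P positive_op_nonneg by blast
    ultimately have "\<delta> * (norm z)\<^sup>2 \<le> 0" using \<delta>(2)[of z] by linarith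
    then have "z = 0" using \<delta>(1) by (simp add: mult_le_0_iff)
    then show "P x = R x" by (simp add: z_def)
  qed
  have "sqrt_op Q = R" unfolding sqrt_op_def using R2 uniq by blast
  then show "coercive_op (sqrt_op Q)" and "sqrt_op Q (sqrt_op Q x) = Q x"
    using R by (simp_all add: fun_eq_iff[of "R \<circ> R"])
qed

section \<open>The frame operator\<close>

text \<open>A frame expansion need not converge absolutely, so its convergence is obtained from the Cauchy criterion.\<close>

lemma summable_on_if_tails_small:
  fixes f :: "'b \<Rightarrow> 'a::banach"
  assumes small: "\<And>e. e > 0 \<Longrightarrow> \<exists>F0. finite F0 \<and> F0 \<subseteq> A \<and>
    (\<forall>F. finite F \<longrightarrow> F \<subseteq> A \<longrightarrow> F \<inter> F0 = {} \<longrightarrow> norm (sum f F) < e)"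
  shows "f summable_on A"
proof -
  have "\<exists>P. eventually P (finite_subsets_at_top A) \<and>
              (\<forall>F F'. P F \<and> P F' \<longrightarrow> dist (sum f F) (sum f F') < e)" if e: "e > 0" for e
  proof -
    obtain F0 where F0: "finite F0" "F0 \<subseteq> A"
      and tail: "\<And>F. finite F \<Longrightarrow> F \<subseteq> A \<Longrightarrow> F \<inter> F0 = {} \<Longrightarrow> norm (sum f F) < e / 2"
      using small[of "e / 2"] e by auto
    define P where "P F \<longleftrightarrow> finite F \<and> F0 \<subseteq> F \<and> F \<subseteq> A" for F
    have "eventually P (finite_subsets_at_top A)"
      unfolding eventually_finite_subsets_at_top P_def using F0 by blast
    moreover have "dist (sum f F) (sum f F') < e" if "P F" "P F'" for F F'
    proof -
      have "sum f F - sum f F' = sum f (F - F0) - sum f (F' - F0)"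
        using that F0 by (simp add: P_def sum_diff)
      moreover have "norm (sum f (F - F0)) < e / 2" "norm (sum f (F' - F0)) < e / 2"
        using that tail[of "F - F0"] tail[of "F' - F0"] by (auto simp: P_def)
      ultimately show ?thesis
        using norm_triangle_ineq4[of "sum f (F - F0)" "sum f (F' - F0)"] by (simp add: dist_norm)
    qed
    ultimately show ?thesis by blast
  qed
  then have "cauchy_filter (filtermap (sum f) (finite_subsets_at_top A))"
    by (simp add: cauchy_filter_metric_filtermap)
  moreover have "complete (UNIV :: 'a set)" by (rule complete_UNIV)
  ultimately obtain L where "(sum f \<longlongrightarrow> L) (finite_subsets_at_top A)"
    using complete_uniform[where S = UNIV] by (force simp add: filterlim_def)
  then show ?thesis using summable_on_def has_sum_def by blast
qed

lemma cinner_rank_one: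
  "cinner (cinner x p *\<^sub>C p) (x::'a::complex_inner) = of_real ((cmod (cinner x p))\<^sup>2)"
  using cinner_commute[of p x] complex_norm_square[of "cinner x p"]
  by (simp add: cinner_scaleC_left)

context
  fixes K :: "'k set" and g :: "'k \<Rightarrow> 'a::complex_hilbert" and \<beta> :: real
  assumes \<beta>: "\<beta> > 0"
    and summable: "\<And>h. (\<lambda>k. (cmod (cinner h (g k)))\<^sup>2) summable_on K"
    and upper: "\<And>h. (\<Sum>\<^sub>\<infinity>k\<in>K. (cmod (cinner h (g k)))\<^sup>2) \<le> \<beta> * (norm h)\<^sup>2"
begin

text \<open>The analysis operator and its adjoint, the synthesis operator, have the same norm.\<close>

lemma bessel_synthesis_bound:
  assumes F: "finite F" "F \<subseteq> K"
  shows "(norm (\<Sum>k\<in>F. c k *\<^sub>C g k))\<^sup>2 \<le> \<beta> * (\<Sum>k\<in>F. (cmod (c k))\<^sup>2)"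
proof -
  define w where "w = (\<Sum>k\<in>F. c k *\<^sub>C g k)"
  define n where "n = (norm w)\<^sup>2"
  have "n = cmod (cinner w w)" by (simp add: cinner_self n_def norm_power)
  also have "cinner w w = (\<Sum>k\<in>F. c k * cinner (g k) w)"
    by (subst w_def) (simp add: cinner_sum_left cinner_scaleC_left)
  also have "cmod \<dots> \<le> (\<Sum>k\<in>F. cmod (c k) * cmod (cinner w (g k)))"
    by (rule order_trans[OF norm_sum]) (auto intro!: sum_mono simp: norm_mult,
        metis cinner_commute complex_mod_cnj order_refl mult_left_mono norm_ge_zero)
  finally have "n\<^sup>2 \<le> (\<Sum>k\<in>F. cmod (c k) * cmod (cinner w (g k)))\<^sup>2"
    by (rule power_mono) (simp add: n_def)
  also have "\<dots> \<le> (\<Sum>k\<in>F. (cmod (c k))\<^sup>2) * (\<Sum>k\<in>F. (cmod (cinner w (g k)))\<^sup>2)"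
    by (rule Cauchy_Schwarz_ineq_sum)
  also have "\<dots> \<le> (\<Sum>k\<in>F. (cmod (c k))\<^sup>2) * (\<beta> * n)"
  proof (rule mult_left_mono)
    have "(\<Sum>k\<in>F. (cmod (cinner w (g k)))\<^sup>2) \<le> (\<Sum>\<^sub>\<infinity>k\<in>K. (cmod (cinner w (g k)))\<^sup>2)"
      by (rule finite_sum_le_infsum[OF summable F]) simp
    also have "\<dots> \<le> \<beta> * n" unfolding n_def by (rule upper)
    finally show "(\<Sum>k\<in>F. (cmod (cinner w (g k)))\<^sup>2) \<le> \<beta> * n" .
  qed (simp add: sum_nonneg)
  finally have "n * n \<le> n * (\<beta> * (\<Sum>k\<in>F. (cmod (c k))\<^sup>2))"
    by (simp add: power2_eq_square mult_ac)
  moreover have "0 \<le> \<beta> * (\<Sum>k\<in>F. (cmod (c k))\<^sup>2)" using \<beta> by (simp add: sum_nonneg)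
  ultimately have "n \<le> \<beta> * (\<Sum>k\<in>F. (cmod (c k))\<^sup>2)"
    by (cases "n > 0") (metis mult_le_cancel_left_pos, simp add: n_def)
  then show ?thesis by (simp add: n_def w_def)
qed

lemma frame_operator_has_sum:
  "((\<lambda>k. cinner h (g k) *\<^sub>C g k) has_sum frame_operator K g h) K"
proof -
  define a where "a = (\<lambda>k. (cmod (cinner h (g k)))\<^sup>2)"
  have "(\<lambda>k. cinner h (g k) *\<^sub>C g k) summable_on K"
  proof (rule summable_on_if_tails_small)
    fix e :: real assume e: "e > 0"
    \<comment> \<open>a tail of the coefficients of energy at most \<open>e\<^sup>2 / (2 \<beta>)\<close> gives a vector of norm at most \<open>e / \<surd>2 < e\<close>\<close>
    have "e\<^sup>2 / (2 * \<beta>) > 0" using e \<beta> by simp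
    then obtain F0 where F0: "finite F0" "F0 \<subseteq> K"
      and approx: "dist (sum a F0) (infsum a K) \<le> e\<^sup>2 / (2 * \<beta>)"
      using infsum_finite_approximation[of a K] summable[of h] unfolding a_def by blast
    have "norm (\<Sum>k\<in>F. cinner h (g k) *\<^sub>C g k) < e" if F: "finite F" "F \<subseteq> K" "F \<inter> F0 = {}" for F
    proof -
      have "sum a F0 + sum a F = sum a (F0 \<union> F)"
        using F F0 by (subst sum.union_disjoint) auto
      also have "\<dots> \<le> infsum a K"
        unfolding a_def by (rule finite_sum_le_infsum[OF summable]) (use F F0 in auto)
      finally have "sum a F \<le> e\<^sup>2 / (2 * \<beta>)" using approx by (simp add: dist_real_def)
      then have "\<beta> * sum a F \<le> e\<^sup>2 / 2" using \<beta> by (simp add: field_simps)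
      then have "(norm (\<Sum>k\<in>F. cinner h (g k) *\<^sub>C g k))\<^sup>2 \<le> e\<^sup>2 / 2"
        using bessel_synthesis_bound[OF F(1,2), of "\<lambda>k. cinner h (g k)"] by (simp add: a_def)
      also have "\<dots> < e\<^sup>2" using e by simp
      finally show ?thesis using e by (simp add: power_less_imp_less_base)
    qed
    then show "\<exists>F0. finite F0 \<and> F0 \<subseteq> K \<and> (\<forall>F. finite F \<longrightarrow> F \<subseteq> K \<longrightarrow> F \<inter> F0 = {} \<longrightarrow>
        norm (\<Sum>k\<in>F. cinner h (g k) *\<^sub>C g k) < e)"
      using F0 by blast
  qed
  then show ?thesis unfolding frame_operator_def by (rule has_sum_infsum)
qed

lemma frame_operator_clinear: "clinear_op (frame_operator K g)"
  unfolding clinear_op_def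
proof (intro conjI allI)
  fix x y c
  have "((\<lambda>k. cinner (x + y) (g k) *\<^sub>C g k) has_sum (frame_operator K g x + frame_operator K g y)) K"
    using has_sum_add[OF frame_operator_has_sum[of x] frame_operator_has_sum[of y]]
    by (simp add: cinner_add_left scaleC_add_left)
  then show "frame_operator K g (x + y) = frame_operator K g x + frame_operator K g y"
    by (rule has_sum_unique[OF frame_operator_has_sum])
  have "((\<lambda>k. cinner (c *\<^sub>C x) (g k) *\<^sub>C g k) has_sum (c *\<^sub>C frame_operator K g x)) K"
    using has_sum_bounded_linear[OF bounded_linear_scaleC_right frame_operator_has_sum[of x], of c]
    by (simp add: cinner_scaleC_left scaleC_scaleC)
  then show "frame_operator K g (c *\<^sub>C x) = c *\<^sub>C frame_operator K g x"
    by (rule has_sum_unique[OF frame_operator_has_sum])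
qed

lemma frame_operator_form:
  "cinner (frame_operator K g h) h = of_real (\<Sum>\<^sub>\<infinity>k\<in>K. (cmod (cinner h (g k)))\<^sup>2)"
proof (rule has_sum_unique)
  show "((\<lambda>k. of_real ((cmod (cinner h (g k)))\<^sup>2)) has_sum cinner (frame_operator K g h) h) K"
    using has_sum_bounded_linear[OF bounded_linear_cinner_left frame_operator_has_sum, of h h]
    by (simp only: cinner_rank_one)
  show "((\<lambda>k. of_real ((cmod (cinner h (g k)))\<^sup>2)) has_sum
      complex_of_real (\<Sum>\<^sub>\<infinity>k\<in>K. (cmod (cinner h (g k)))\<^sup>2)) K"
    by (rule has_sum_of_real[OF has_sum_infsum[OF summable]])
qed

end

lemma
  fixes g :: "'k \<Rightarrow> 'a::complex_hilbert"
  assumes "frame K g"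
  shows frame_summable: "(\<lambda>k. (cmod (cinner h (g k)))\<^sup>2) summable_on K"
    and coercive_frame_operator: "coercive_op (frame_operator K g)"
    and frame_operator_energy:
      "cinner (frame_operator K g h) h = of_real (\<Sum>\<^sub>\<infinity>k\<in>K. (cmod (cinner h (g k)))\<^sup>2)"
proof -
  obtain \<alpha> \<beta> where \<alpha>: "\<alpha> > 0" and \<beta>: "\<beta> > 0"
    and summable: "\<And>h. (\<lambda>k. (cmod (cinner h (g k)))\<^sup>2) summable_on K"
    and lower: "\<And>h. \<alpha> * (norm h)\<^sup>2 \<le> (\<Sum>\<^sub>\<infinity>k\<in>K. (cmod (cinner h (g k)))\<^sup>2)"
    and upper: "\<And>h. (\<Sum>\<^sub>\<infinity>k\<in>K. (cmod (cinner h (g k)))\<^sup>2) \<le> \<beta> * (norm h)\<^sup>2"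
    using assms unfolding frame_def by auto
  note form = frame_operator_form[OF \<beta> summable upper]
  show "(\<lambda>k. (cmod (cinner h (g k)))\<^sup>2) summable_on K" by (rule summable)
  show "cinner (frame_operator K g h) h = of_real (\<Sum>\<^sub>\<infinity>k\<in>K. (cmod (cinner h (g k)))\<^sup>2)" by (rule form)
  have "positive_op (frame_operator K g)"
    by (rule positive_opI[OF frame_operator_clinear[OF \<beta> summable upper]])
       (use upper in \<open>auto simp: form intro: infsum_nonneg\<close>)
  then show "coercive_op (frame_operator K g)"
    unfolding coercive_op_def using \<alpha> lower by (auto simp: form)
qed

section \<open>From frames of orbits to stable contractions\<close>

lemma cadjoint_funpow:
  fixes A :: "'a::complex_hilbert \<Rightarrow> 'a"
  assumes A: "bounded_clinear A"
  shows "cinner ((cadjoint A ^^ n) h) x = cinner h ((A ^^ n) x)"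
proof (induction n arbitrary: h)
  case (Suc n)
  then show ?case by (simp add: funpow_Suc_right cadjoint_works'[OF A] del: funpow.simps(2))
    (simp add: funpow_swap1)
qed simp

text \<open>Applying \<open>A\<^sup>*\<close> shifts the coefficients of \<open>h\<close> with respect to the orbit by one step in \<open>n\<close>; so
  \<open>A\<^sup>*\<^sup>N\<close> removes the first \<open>N\<close> layers of the energy.\<close>

lemma orbit_energy:
  fixes A :: "'a::complex_hilbert \<Rightarrow> 'a" and I :: "'i set"
  assumes A: "bounded_clinear A" and frame: "frame (UNIV \<times> I) (orbit A f)"
  defines "E \<equiv> (\<lambda>h. \<Sum>\<^sub>\<infinity>k\<in>UNIV \<times> I. (cmod (cinner h (orbit A f k)))\<^sup>2)"
  shows orbit_energy_cadjoint: "E (cadjoint A h) = E h - (\<Sum>\<^sub>\<infinity>i\<in>I. (cmod (cinner h (f i)))\<^sup>2)"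
    and orbit_energy_tendsto: "(\<lambda>N. E ((cadjoint A ^^ N) h)) \<longlonglongrightarrow> 0"
proof -
  define a where "a = (\<lambda>n h. \<Sum>\<^sub>\<infinity>i\<in>I. (cmod (cinner h ((A ^^ n) (f i))))\<^sup>2)"
  have layers: "(\<lambda>n. a n h) sums E h" for h
  proof -
    have total: "((\<lambda>k. (cmod (cinner h (orbit A f k)))\<^sup>2) has_sum E h) (UNIV \<times> I)"
      unfolding E_def by (rule has_sum_infsum[OF frame_summable[OF frame]])
    have "(\<lambda>i. (cmod (cinner h (orbit A f (n, i))))\<^sup>2) summable_on I" for n
      by (rule summable_on_SigmaD1[where A = UNIV and B = "\<lambda>_. I"
            and f = "\<lambda>n i. (cmod (cinner h (orbit A f (n, i))))\<^sup>2"])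
         (use frame_summable[OF frame, of h] in \<open>simp_all add: case_prod_beta'\<close>)
    then have "((\<lambda>i. (cmod (cinner h (orbit A f (n, i))))\<^sup>2) has_sum a n h) I" for n
      using has_sum_infsum by (fastforce simp: a_def orbit_def)
    then have "((\<lambda>n. a n h) has_sum E h) UNIV"
      by (rule has_sum_SigmaD[OF total])
    then show ?thesis by (rule has_sum_imp_sums)
  qed
  have shift: "a n ((cadjoint A ^^ N) h) = a (n + N) h" for n N h
    by (simp add: a_def cadjoint_funpow[OF A] funpow_add add.commute[of n N])
  have tail: "E ((cadjoint A ^^ N) h) = E h - (\<Sum>n<N. a n h)" for N h
    by (rule sums_unique2[OF layers[of "(cadjoint A ^^ N) h"]])
       (use sums_split_initial_segment[OF layers[of h], of N] in \<open>simp add: shift\<close>)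
  show "E (cadjoint A h) = E h - (\<Sum>\<^sub>\<infinity>i\<in>I. (cmod (cinner h (f i)))\<^sup>2)"
    using tail[of 1 h] by (simp add: a_def)
  have "(\<lambda>N. E h - (\<Sum>n<N. a n h)) \<longlonglongrightarrow> E h - E h"
    using layers[of h] by (intro tendsto_diff tendsto_const) (simp add: sums_def)
  then show "(\<lambda>N. E ((cadjoint A ^^ N) h)) \<longlonglongrightarrow> 0" by (simp add: tail)
qed

lemma funpow_conjugate:
  assumes "\<And>x. R' (R x) = x"
  shows "((R \<circ> B \<circ> R') ^^ n) (R h) = R ((B ^^ n) h)"
  by (induction n) (simp_all add: assms)

text \<open>The norm of \<open>S\<^bsup>1/2\<^esup> h\<close> is the energy of \<open>h\<close>, so conjugation by \<open>S\<^bsup>1/2\<^esup>\<close> turns loss of energy into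
  loss of norm.\<close>

lemma frame_contraction:
  fixes A :: "'a::complex_hilbert \<Rightarrow> 'a" and I :: "'i set"
  assumes A: "bounded_clinear A" and frame: "frame (UNIV \<times> I) (orbit A f)"
  defines "S \<equiv> frame_operator (UNIV \<times> I) (orbit A f)"
  defines "T \<equiv> sqrt_op S \<circ> cadjoint A \<circ> inv (sqrt_op S)"
  shows "contraction T" and "strongly_stable T" and "similar_op (cadjoint A) T"
    and "(norm x)\<^sup>2 - (norm (T x))\<^sup>2 = (\<Sum>\<^sub>\<infinity>i\<in>I. (cmod (cinner x (inv (sqrt_op S) (f i))))\<^sup>2)"
proof -
  define E where "E = (\<lambda>h. \<Sum>\<^sub>\<infinity>k\<in>UNIV \<times> I. (cmod (cinner h (orbit A f k)))\<^sup>2)"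
  define R where "R = sqrt_op S"
  have S: "coercive_op S" unfolding S_def by (rule coercive_frame_operator[OF frame])
  have R: "coercive_op R" and RR: "\<And>x. R (R x) = S x"
    unfolding R_def using coercive_sqrt_op[OF S] sqrt_op_sqrt_op[OF S] by auto
  have posR: "positive_op R" using R by (rule coercive_imp_positive_op)
  have bij: "bij R" and Rinv: "bounded_clinear (inv R)" using coercive_op_bij[OF R] by auto
  have RI [simp]: "R (inv R x) = x" "inv R (R x) = x" for x
    using bij by (auto simp: bij_is_surj bij_is_inj surj_f_inv_f)
  note Rbc = positive_op_bounded_clinear[OF posR]
  have T: "T = R \<circ> cadjoint A \<circ> inv R" by (simp add: T_def R_def)
  have normR: "(norm (R h))\<^sup>2 = E h" for h
  proof -
    have "complex_of_real ((norm (R h))\<^sup>2) = cinner (R h) (R h)" by (simp only: cinner_self)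
    also have "\<dots> = cinner (S h) h"
      using positive_op_hermitian[OF posR, of "R h" h] by (simp add: RR)
    also have "\<dots> = of_real (E h)" unfolding S_def E_def by (rule frame_operator_energy[OF frame])
    finally show ?thesis by (simp only: of_real_eq_iff)
  qed
  have defect: "(norm x)\<^sup>2 - (norm (T x))\<^sup>2 = (\<Sum>\<^sub>\<infinity>i\<in>I. (cmod (cinner x (inv R (f i))))\<^sup>2)" for x
  proof -
    have "cinner (inv R x) y = cinner x (inv R y)" for y
      using positive_op_hermitian[OF posR, of "inv R x" "inv R y"] by simp
    then show ?thesis
      using normR[of "inv R x"] normR[of "cadjoint A (inv R x)"] orbit_energy_cadjoint[OF A frame, of "inv R x"]
      by (simp add: T E_def)
  qed
  then show "(norm x)\<^sup>2 - (norm (T x))\<^sup>2 = (\<Sum>\<^sub>\<infinity>i\<in>I. (cmod (cinner x (inv (sqrt_op S) (f i))))\<^sup>2)"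
    by (simp add: R_def)
  have "norm (T x) \<le> 1 * norm x" for x
  proof -
    have "0 \<le> (norm x)\<^sup>2 - (norm (T x))\<^sup>2" unfolding defect by (rule infsum_nonneg) simp
    then have "(norm (T x))\<^sup>2 \<le> (norm x)\<^sup>2" by simp
    then have "norm (T x) \<le> norm x" by (rule power2_le_imp_le) simp
    then show ?thesis by simp
  qed
  then have "onorm T \<le> 1" by (intro onorm_bound) auto
  moreover have "bounded_clinear T"
    unfolding T comp_def by (intro bounded_clinear_compose[OF Rbc] bounded_clinear_compose[OF _ Rinv]
        bounded_clinear_cadjoint[OF A])
  ultimately show "contraction T" by (simp add: contraction_def)
  show "strongly_stable T"
    unfolding strongly_stable_def
  proof
    fix x
    have "(norm ((T ^^ n) x))\<^sup>2 = E ((cadjoint A ^^ n) (inv R x))" for n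
      using funpow_conjugate[where R = R and R' = "inv R" and h = "inv R x"] normR by (simp add: T)
    then have "(\<lambda>n. (norm ((T ^^ n) x))\<^sup>2) \<longlonglongrightarrow> 0"
      using orbit_energy_tendsto[OF A frame, of "inv R x"] by (simp add: E_def)
    then have "(\<lambda>n. sqrt ((norm ((T ^^ n) x))\<^sup>2)) \<longlonglongrightarrow> sqrt 0" by (rule tendsto_real_sqrt)
    then show "(\<lambda>n. (T ^^ n) x) \<longlonglongrightarrow> 0" by (simp add: tendsto_norm_zero_iff)
  qed
  show "similar_op (cadjoint A) T"
    unfolding similar_op_def
    by (rule exI[of _ "inv R"])
       (use bij Rbc Rinv in \<open>auto simp: T fun_eq_iff inv_inv_eq bij_imp_bij_inv\<close>)
qed

text \<open>A basis chosen inside the range is an independent subset of a finitely generated space, hence finite.\<close>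

lemma finite_cdim_range:
  assumes D: "clinear_op D" and sub: "range D \<subseteq> cspan B" and B: "finite B"
  shows "finite_cdim (range D)"
proof -
  have subspace: "complex_vector.subspace (range D)"
    unfolding complex_vector.subspace_def
    by (auto simp flip: clinear_op_add[OF D] clinear_op_scaleC[OF D])
       (metis clinear_op_zero[OF D] rangeI)
  obtain C where C: "C \<subseteq> range D" "complex_vector.independent C" "range D \<subseteq> cspan C"
    by (rule complex_vector.maximal_independent_subset)
  have "finite C"
    using complex_vector.independent_span_bound[OF B C(2)] C(1) sub by blast
  moreover have "range D = cspan C"
    using complex_vector.span_subspace[OF C(1,3) subspace] by simp
  ultimately show ?thesis unfolding finite_cdim_def by blast
qed

text \<open>By polarisation the identity \<open>\<langle>(I - T\<^sup>*T) x, x\<rangle> = \<Sum>\<^sub>i \<bar>\<langle>x, p\<^sub>i\<rangle>\<bar>\<^sup>2\<close> is an identity between operators.\<close>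

lemma finite_cdim_defect:
  fixes T :: "'a::complex_hilbert \<Rightarrow> 'a"
  assumes T: "bounded_clinear T" and I: "finite I"
    and defect: "\<And>x. (norm x)\<^sup>2 - (norm (T x))\<^sup>2 = (\<Sum>i\<in>I. (cmod (cinner x (p i)))\<^sup>2)"
  shows "finite_cdim (range (\<lambda>x. x - cadjoint T (T x)))"
proof -
  define D where "D = (\<lambda>x. x - cadjoint T (T x))"
  have D: "clinear_op D" unfolding D_def
    by (intro bounded_clinear_imp_clinear_op bounded_clinear_diff bounded_clinear_id
        bounded_clinear_compose[OF bounded_clinear_cadjoint T] T)
  have "D x = (\<Sum>i\<in>I. cinner x (p i) *\<^sub>C p i)" for x
  proof (rule operator_eqI_quadratic[OF D])
    show "clinear_op (\<lambda>x. \<Sum>i\<in>I. cinner x (p i) *\<^sub>C p i)"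
      by (simp add: clinear_op_def cinner_add_left scaleC_add_left sum.distrib cinner_scaleC_left
          complex_vector.scale_sum_right scaleC_scaleC)
    fix x
    have "cinner (\<Sum>i\<in>I. cinner x (p i) *\<^sub>C p i) x = of_real (\<Sum>i\<in>I. (cmod (cinner x (p i)))\<^sup>2)"
      by (simp only: cinner_sum_left cinner_rank_one of_real_sum)
    also have "\<dots> = cinner (D x) x"
      by (simp add: D_def cinner_diff_left cadjoint_works'[OF T] cinner_self flip: defect)
    finally show "cinner (D x) x = cinner (\<Sum>i\<in>I. cinner x (p i) *\<^sub>C p i) x" by simp
  qed
  then have "range D \<subseteq> cspan (p ` I)"
    by (auto intro!: complex_vector.span_sum complex_vector.span_scale intro: complex_vector.span_base)
  then have "finite_cdim (range D)" by (rule finite_cdim_range[OF D]) (use I in simp)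
  then show ?thesis by (simp add: D_def)
qed

section \<open>Rank-one decompositions of positive operators\<close>

text \<open>If the form vanishes at \<open>x\<close>, the factor is \<open>1 / 0 = 0\<close> and no vector is split off; the Cauchy--Schwarz
  inequality yields \<open>Q x = 0\<close> in this case.\<close>

definition pivot_vector :: "('a::complex_inner \<Rightarrow> 'a) \<Rightarrow> 'a \<Rightarrow> 'a" where
  "pivot_vector Q x = (1 / sqrt (Re (cinner (Q x) x))) *\<^sub>R Q x"

definition deflate :: "('a::complex_inner \<Rightarrow> 'a) \<Rightarrow> 'a \<Rightarrow> 'a \<Rightarrow> 'a" where
  "deflate Q x u = Q u - cinner u (pivot_vector Q x) *\<^sub>C pivot_vector Q x"

text \<open>This is one step of the Cholesky decomposition. The Cauchy--Schwarz inequality for the form of \<open>Q\<close>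
  says that the remainder is again positive.\<close>

lemma
  fixes Q :: "'a::complex_inner \<Rightarrow> 'a"
  assumes Q: "positive_op Q"
  shows deflate_form:
      "Re (cinner (Q u) u) = (cmod (cinner u (pivot_vector Q x)))\<^sup>2 + Re (cinner (deflate Q x u) u)"
    and deflate_positive: "positive_op (deflate Q x)"
    and deflate_self: "deflate Q x x = 0"
    and deflate_null: "Q y = 0 \<Longrightarrow> deflate Q x y = 0"
proof -
  define a where "a = Re (cinner (Q x) x)"
  define p where "p = pivot_vector Q x"
  note lin = positive_op_clinear[OF Q]
  have a0: "a \<ge> 0" unfolding a_def by (rule positive_op_nonneg[OF Q])
  have a: "cinner (Q x) x = of_real a"
    using positive_op_real[OF Q, of x] by (simp add: a_def complex_is_Real_iff complex_eq_iff)
  have p: "p = (1 / sqrt a) *\<^sub>R Q x" by (simp add: p_def pivot_vector_def a_def)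
  have coeff: "cinner u p = of_real (1 / sqrt a) * cinner (Q u) x" for u
    unfolding p by (simp add: cinner_scaleR_right positive_op_hermitian[OF Q])
  have form: "cinner (deflate Q x u) u = cinner (Q u) u - of_real ((cmod (cinner u p))\<^sup>2)" for u
    by (simp only: deflate_def cinner_diff_left cinner_rank_one flip: p_def)
  show "Re (cinner (Q u) u) = (cmod (cinner u (pivot_vector Q x)))\<^sup>2 + Re (cinner (deflate Q x u) u)"
    using form[of u] by (simp add: p_def del: of_real_power)
  have le: "(cmod (cinner u p))\<^sup>2 \<le> Re (cinner (Q u) u)" for u
  proof (cases "a = 0")
    case False
    have "(cmod (cinner u p))\<^sup>2 = (cmod (cinner (Q u) x))\<^sup>2 / a"
      using a0 by (simp add: coeff norm_mult norm_divide power_mult_distrib power_divide)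
    also have "\<dots> \<le> Re (cinner (Q u) u) * a / a"
      using positive_op_Cauchy_Schwarz[OF Q, of u x] a0 by (intro divide_right_mono) (simp_all flip: a_def)
    finally show ?thesis using False by simp
  qed (simp add: coeff positive_op_nonneg[OF Q])
  show "positive_op (deflate Q x)"
  proof -
    obtain K where K: "\<And>u. norm (Q u) \<le> norm u * K"
      using bounded_linear.bounded positive_op_bounded_clinear[OF Q] bounded_clinear_imp_bounded_linear
      by blast
    show ?thesis
    proof (rule positive_opI[where c = K])
      show "clinear_op (deflate Q x)"
        by (simp add: clinear_op_def deflate_def clinear_op_add[OF lin] clinear_op_scaleC[OF lin]
            cinner_add_left cinner_scaleC_left scaleC_add_left complex_vector.scale_right_diff_distrib)
      fix u
      show "cinner (deflate Q x u) u \<in> \<real>"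
        unfolding form by (intro Reals_diff Reals_of_real positive_op_real[OF Q])
      show "0 \<le> Re (cinner (deflate Q x u) u)" unfolding form using le[of u] by (simp del: of_real_power)
      have "Re (cinner (deflate Q x u) u) \<le> Re (cinner (Q u) u)"
        unfolding form by (simp del: of_real_power)
      also have "\<dots> \<le> norm (Q u) * norm u"
        using Cauchy_Schwarz complex_Re_le_cmod order_trans by blast
      also have "\<dots> \<le> norm u * K * norm u" by (intro mult_right_mono K) simp
      finally show "Re (cinner (deflate Q x u) u) \<le> K * (norm u)\<^sup>2"
        by (simp add: power2_eq_square mult_ac)
    qed
  qed
  show "deflate Q x y = 0" if "Q y = 0" for y
    using that by (simp add: deflate_def coeff flip: p_def)
  show "deflate Q x x = 0"
  proof (cases "a = 0")
    case True
    then have "cinner (Q x) y = 0" for y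
      using positive_op_Cauchy_Schwarz[OF Q, of x y] by (simp flip: a_def)
    then have "Q x = 0" using cinner_eq_zero_iff by blast
    then show ?thesis by (simp add: deflate_def coeff flip: p_def)
  next
    case False
    then have "a > 0" using a0 by simp
    have "cinner x p = of_real (a / sqrt a)" by (simp add: coeff a)
    then have "cinner x p *\<^sub>C p = (a / sqrt a) *\<^sub>R (1 / sqrt a) *\<^sub>R Q x"
      by (simp only: p scaleC_of_real)
    also have "\<dots> = Q x" using \<open>a > 0\<close> by (simp add: real_div_sqrt)
    finally have "cinner x p *\<^sub>C p = Q x" .
    then show ?thesis by (simp add: deflate_def flip: p_def)
  qed
qed

primrec deflate_seq :: "('a::complex_inner \<Rightarrow> 'a) \<Rightarrow> (nat \<Rightarrow> 'a) \<Rightarrow> nat \<Rightarrow> 'a \<Rightarrow> 'a" where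
  "deflate_seq Q x 0 = Q"
| "deflate_seq Q x (Suc n) = deflate (deflate_seq Q x n) (x n)"

lemma deflate_seq_positive: "positive_op Q \<Longrightarrow> positive_op (deflate_seq Q x n)"
  by (induction n) (auto intro: deflate_positive)

lemma deflate_seq_form:
  assumes Q: "positive_op Q"
  shows "Re (cinner (Q u) u) = (\<Sum>j<n. (cmod (cinner u (pivot_vector (deflate_seq Q x j) (x j))))\<^sup>2)
    + Re (cinner (deflate_seq Q x n u) u)"
  by (induction n) (use deflate_form[OF deflate_seq_positive[OF Q]] in auto)

lemma deflate_seq_null:
  assumes Q: "positive_op Q" and "deflate_seq Q x m u = 0" and "m \<le> n"
  shows "deflate_seq Q x n u = 0"
  using assms(3,2) by (induction n rule: dec_induct) (auto intro: deflate_null deflate_seq_positive[OF Q])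

lemma deflate_seq_self:
  assumes Q: "positive_op Q" and "j < n"
  shows "deflate_seq Q x n (x j) = 0"
  by (rule deflate_seq_null[OF Q, of _ "Suc j"])
     (use assms in \<open>auto intro: deflate_self deflate_seq_positive[OF Q]\<close>)

text \<open>With a dense sequence of pivots the remainders \<open>Q\<^sub>n\<close> tend to zero: if \<open>c\<close> is a pivot close to \<open>u\<close>, then
  eventually \<open>Q\<^sub>n c = 0\<close> and \<open>\<langle>Q\<^sub>n u, u\<rangle> = \<langle>Q\<^sub>n (u - c), u - c\<rangle> \<le> \<langle>Q (u - c), u - c\<rangle>\<close>.\<close>

lemma positive_op_rank_one_series:
  fixes Q :: "'a::complex_inner \<Rightarrow> 'a"
  assumes sep: "separable_space (euclidean :: 'a topology)" and Q: "positive_op Q"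
  shows "\<exists>p :: nat \<Rightarrow> 'a. \<forall>u. (\<lambda>j. (cmod (cinner u (p j)))\<^sup>2) sums Re (cinner (Q u) u)"
proof -
  obtain C :: "'a set" where C: "countable C" "closure C = UNIV"
    using sep by (auto simp: separable_space_def)
  have ne: "C \<noteq> {}" using C(2) by auto
  define x where "x = from_nat_into C"
  have x: "range x = C" unfolding x_def by (rule range_from_nat_into[OF ne C(1)])
  obtain K where K: "K > 0" "\<And>u. norm (Q u) \<le> norm u * K"
    using bounded_linear.pos_bounded positive_op_bounded_clinear[OF Q] bounded_clinear_imp_bounded_linear
    by blast
  have bound: "Re (cinner (Q u) u) \<le> K * (norm u)\<^sup>2" for u
  proof -
    have "Re (cinner (Q u) u) \<le> norm (Q u) * norm u"
      using Cauchy_Schwarz complex_Re_le_cmod order_trans by blast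
    also have "\<dots> \<le> norm u * K * norm u" by (intro mult_right_mono K) simp
    finally show ?thesis by (simp add: power2_eq_square mult_ac)
  qed
  define P where "P = deflate_seq Q x"
  have P: "positive_op (P n)" for n unfolding P_def by (rule deflate_seq_positive[OF Q])
  have Ple: "Re (cinner (P n v) v) \<le> Re (cinner (Q v) v)" for n v
    using deflate_seq_form[OF Q, where u = v and n = n and x = x] by (simp add: P_def sum_nonneg)
  have lim: "(\<lambda>n. Re (cinner (P n u) u)) \<longlonglongrightarrow> 0" for u
  proof (rule LIMSEQ_I)
    fix e :: real assume e: "e > 0"
    then have "sqrt (e / K) > 0" using K by simp
    moreover have "u \<in> closure C" using C(2) by simp
    ultimately obtain c where c: "c \<in> C" "dist c u < sqrt (e / K)"
      unfolding closure_approachable by blast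
    then obtain i where i: "x i = c" using x by blast
    have "(norm (u - c))\<^sup>2 < (sqrt (e / K))\<^sup>2"
      using c(2) by (intro power_strict_mono) (auto simp: dist_norm norm_minus_commute)
    then have small: "K * (norm (u - c))\<^sup>2 < e" using K e by (simp add: field_simps)
    have "norm (Re (cinner (P n u) u) - 0) < e" if n: "n \<ge> Suc i" for n
    proof -
      have "P n c = 0" unfolding P_def i[symmetric] by (rule deflate_seq_self[OF Q]) (use n in simp)
      then have shift: "P n u = P n (u - c)"
        by (simp add: clinear_op_diff[OF positive_op_clinear[OF P]])
      have "cinner (P n u) u = cinner u (P n (u - c))"
        using positive_op_hermitian[OF P, of n u u] by (simp only: shift)
      also have "\<dots> = cinner (P n u) (u - c)" by (rule positive_op_hermitian[OF P, symmetric])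
      also have "\<dots> = cinner (P n (u - c)) (u - c)" by (simp only: shift)
      finally have "Re (cinner (P n u) u) \<le> K * (norm (u - c))\<^sup>2"
        using Ple[of n "u - c"] bound[of "u - c"] by simp
      then show ?thesis using small positive_op_nonneg[OF P, of n u] by simp
    qed
    then show "\<exists>no. \<forall>n\<ge>no. norm (Re (cinner (P n u) u) - 0) < e" by blast
  qed
  have "(\<lambda>j. (cmod (cinner u (pivot_vector (P j) (x j))))\<^sup>2) sums Re (cinner (Q u) u)" for u
  proof -
    have "(\<lambda>n. Re (cinner (Q u) u) - Re (cinner (P n u) u)) \<longlonglongrightarrow> Re (cinner (Q u) u) - 0"
      by (intro tendsto_diff tendsto_const lim)
    moreover have "Re (cinner (Q u) u) - Re (cinner (P n u) u)
        = (\<Sum>j<n. (cmod (cinner u (pivot_vector (P j) (x j))))\<^sup>2)" for n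
      using deflate_seq_form[OF Q, where u = u and n = n and x = x] by (simp add: P_def)
    ultimately show ?thesis by (simp add: sums_def)
  qed
  then show ?thesis by (intro exI allI)
qed

text \<open>Pivots whose images span the range of \<open>Q\<close> span, together with the null space of \<open>Q\<close>, the whole space;
  hence the last remainder is zero.\<close>

lemma positive_op_rank_one_sum:
  fixes Q :: "'a::complex_inner \<Rightarrow> 'a"
  assumes Q: "positive_op Q" and fin: "finite_cdim (range Q)"
  shows "\<exists>n (p :: nat \<Rightarrow> 'a). \<forall>u. Re (cinner (Q u) u) = (\<Sum>j<n. (cmod (cinner u (p j)))\<^sup>2)"
proof -
  note lin = positive_op_clinear[OF Q]
  obtain B where B: "finite B" "range Q = cspan B" using fin by (auto simp: finite_cdim_def)
  obtain n :: nat and h where h: "B = h ` {..<n}"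
    using finite_imp_nat_seg_image_inj_on[OF B(1)] by (auto simp: lessThan_def)
  have "h j \<in> range Q" if "j < n" for j
    using that h B(2) complex_vector.span_base[of "h j" B] by blast
  then have "\<exists>w. Q w = h j" if "j < n" for j using that by (metis imageE)
  then obtain x where x: "\<And>j. j < n \<Longrightarrow> Q (x j) = h j" by metis
  define P where "P = deflate_seq Q x n"
  have P: "clinear_op P" unfolding P_def by (rule positive_op_clinear[OF deflate_seq_positive[OF Q]])
  have "\<exists>w. Q w = v \<and> P w = 0" if "v \<in> cspan B" for v
    using that
  proof (rule complex_vector.span_induct)
    show "\<exists>w. Q w = b \<and> P w = 0" if b: "b \<in> B" for b
    proof -
      obtain j where "j < n" "b = h j" using b by (auto simp: h)
      then show ?thesis using x deflate_seq_self[OF Q, where x = x and n = n] by (metis P_def)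
    qed
    show "complex_vector.subspace {v. \<exists>w. Q w = v \<and> P w = 0}"
      unfolding complex_vector.subspace_def
      by (auto intro: exI[of _ 0] simp: clinear_op_zero[OF lin] clinear_op_zero[OF P])
        (metis (no_types) clinear_op_add[OF lin] clinear_op_add[OF P] add_0,
         metis (no_types) clinear_op_scaleC[OF lin] clinear_op_scaleC[OF P] complex_vector.scale_zero_right)
  qed
  then have "P u = 0" for u
  proof -
    obtain w where w: "Q w = Q u" "P w = 0"
      using \<open>\<And>v. v \<in> cspan B \<Longrightarrow> \<exists>w. Q w = v \<and> P w = 0\<close>[of "Q u"] B(2) by blast
    then have "Q (u - w) = 0" by (simp add: clinear_op_diff[OF lin])
    then have "deflate_seq Q x 0 (u - w) = 0" by simp
    then have "P (u - w) = 0" unfolding P_def by (rule deflate_seq_null[OF Q]) simp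
    then show ?thesis using w by (simp add: clinear_op_diff[OF P])
  qed
  then have "Re (cinner (Q u) u) = (\<Sum>j<n. (cmod (cinner u (pivot_vector (deflate_seq Q x j) (x j))))\<^sup>2)" for u
    using deflate_seq_form[OF Q, where u = u and n = n and x = x] by (simp add: P_def)
  then show ?thesis by (intro exI allI)
qed

section \<open>From stable contractions to frames of orbits\<close>

lemma contraction_bounded_clinear: "contraction T \<Longrightarrow> bounded_clinear T"
  by (simp add: contraction_def)

lemma contraction_norm_le: "contraction T \<Longrightarrow> norm (T x) \<le> norm x"
  using onorm[of T x] mult_right_mono[of "onorm T" 1 "norm x"]
  by (auto simp: contraction_def bounded_clinear_def)

lemma
  fixes T :: "'a::complex_hilbert \<Rightarrow> 'a"
  assumes T: "contraction T"
  shows positive_op_defect: "positive_op (\<lambda>x. x - cadjoint T (T x))"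
    and defect_form: "Re (cinner (x - cadjoint T (T x)) x) = (norm x)\<^sup>2 - (norm (T x))\<^sup>2"
proof -
  note bT = contraction_bounded_clinear[OF T]
  have form: "cinner (x - cadjoint T (T x)) x = of_real ((norm x)\<^sup>2 - (norm (T x))\<^sup>2)" for x
    by (simp add: cinner_diff_left cadjoint_works'[OF bT] cinner_self)
  show "Re (cinner (x - cadjoint T (T x)) x) = (norm x)\<^sup>2 - (norm (T x))\<^sup>2"
    unfolding form by (simp only: Re_complex_of_real)
  show "positive_op (\<lambda>x. x - cadjoint T (T x))"
  proof (rule positive_opI[where c = 1])
    show "clinear_op (\<lambda>x. x - cadjoint T (T x))"
      by (intro bounded_clinear_imp_clinear_op bounded_clinear_diff bounded_clinear_id
          bounded_clinear_compose[OF bounded_clinear_cadjoint] bT)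
    fix x
    show "cinner (x - cadjoint T (T x)) x \<in> \<real>" unfolding form by (rule Reals_of_real)
    show "0 \<le> Re (cinner (x - cadjoint T (T x)) x)"
      unfolding form Re_complex_of_real using contraction_norm_le[OF T, of x] by (simp add: power_mono)
    show "Re (cinner (x - cadjoint T (T x)) x) \<le> 1 * (norm x)\<^sup>2"
      unfolding form Re_complex_of_real by simp
  qed
qed

text \<open>For \<open>v = L\<^sup>-\<^sup>1 h\<close> the layer \<open>n\<close> of the coefficients of \<open>h\<close> has energy
  \<open>\<parallel>T\<^sup>n v\<parallel>\<^sup>2 - \<parallel>T\<^bsup>n+1\<^esup> v\<parallel>\<^sup>2\<close>. By strong stability these telescope to \<open>\<parallel>v\<parallel>\<^sup>2\<close>, which is comparable to \<open>\<parallel>h\<parallel>\<^sup>2\<close>.\<close>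

lemma frame_if_similar_to_stable_contraction:
  fixes A :: "'a::complex_hilbert \<Rightarrow> 'a"
  assumes A: "bounded_clinear A" and T: "contraction T" and stable: "strongly_stable T"
    and similar: "similar_op (cadjoint A) T"
    and defect: "\<And>u. ((\<lambda>i. (cmod (cinner u (p i)))\<^sup>2) has_sum ((norm u)\<^sup>2 - (norm (T u))\<^sup>2)) I"
  shows "\<exists>f. bessel I f \<and> frame (UNIV \<times> I) (orbit A f)"
proof -
  obtain L where L: "bounded_clinear L" "bij L" "bounded_clinear (inv L)" and AL: "cadjoint A = L \<circ> T \<circ> inv L"
    using similar by (auto simp: similar_op_def)
  have LI: "L (inv L x) = x" "inv L (L x) = x" for x
    using L(2) by (auto simp: bij_is_surj bij_is_inj surj_f_inv_f)
  obtain K where K: "K > 0" "\<And>x. norm (inv L x) \<le> norm x * K"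
    using bounded_linear.pos_bounded bounded_clinear_imp_bounded_linear[OF L(3)] by blast
  obtain M where M: "M > 0" "\<And>x. norm (L x) \<le> norm x * M"
    using bounded_linear.pos_bounded bounded_clinear_imp_bounded_linear[OF L(1)] by blast
  have invL_sqr: "(norm (inv L h))\<^sup>2 \<le> K\<^sup>2 * (norm h)\<^sup>2" for h
    using power_mono[OF K(2)[of h], of 2] by (simp add: power_mult_distrib mult.commute)
  have L_sqr: "(norm h)\<^sup>2 \<le> M\<^sup>2 * (norm (inv L h))\<^sup>2" for h
    using power_mono[OF M(2)[of "inv L h"], of 2] by (simp add: power_mult_distrib mult.commute LI)
  define f where "f = (\<lambda>i. cadjoint (inv L) (p i))"
  have coeff: "cinner h (f i) = cinner (inv L h) (p i)" for h i
    unfolding f_def by (rule cadjoint_works[OF L(3), symmetric])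
  have row: "((\<lambda>i. (cmod (cinner h (f i)))\<^sup>2) has_sum
      ((norm (inv L h))\<^sup>2 - (norm (T (inv L h)))\<^sup>2)) I" for h
    unfolding coeff by (rule defect)
  have "bessel I f"
    unfolding bessel_def
  proof (intro exI[of _ "K\<^sup>2"] conjI allI)
    fix h
    show "(\<lambda>k. (cmod (cinner h (f k)))\<^sup>2) summable_on I" using row by (rule has_sum_imp_summable)
    have "(\<Sum>\<^sub>\<infinity>k\<in>I. (cmod (cinner h (f k)))\<^sup>2) \<le> (norm (inv L h))\<^sup>2"
      unfolding infsumI[OF row] by simp
    then show "(\<Sum>\<^sub>\<infinity>k\<in>I. (cmod (cinner h (f k)))\<^sup>2) \<le> K\<^sup>2 * (norm h)\<^sup>2"
      using invL_sqr order_trans by blast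
  qed (use K in simp)
  have total: "((\<lambda>k. (cmod (cinner h (orbit A f k)))\<^sup>2) has_sum (norm (inv L h))\<^sup>2) (UNIV \<times> I)" for h
  proof -
    define v where "v = inv L h"
    define b where "b = (\<lambda>n. (norm ((T ^^ n) v))\<^sup>2)"
    have "cinner h (orbit A f (n, i)) = cinner ((cadjoint A ^^ n) h) (f i)" for n i
      by (simp add: orbit_def cadjoint_funpow[OF A])
    moreover have "inv L ((cadjoint A ^^ n) h) = (T ^^ n) v" for n
      using funpow_conjugate[where R = L and R' = "inv L" and h = v and B = T and n = n]
      by (simp add: AL LI v_def)
    ultimately have layer: "((\<lambda>i. (cmod (cinner h (orbit A f (n, i))))\<^sup>2) has_sum (b n - b (Suc n))) I" for n
      using row[of "(cadjoint A ^^ n) h"] by (simp add: b_def)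
    have "(\<lambda>n. b n) \<longlonglongrightarrow> (norm (0::'a))\<^sup>2"
      unfolding b_def using stable by (intro tendsto_power tendsto_norm) (simp add: strongly_stable_def)
    then have "(\<lambda>n. b n - b (Suc n)) sums (b 0 - (norm (0::'a))\<^sup>2)"
      by (rule telescope_sums')
    then have "((\<lambda>n. b n - b (Suc n)) has_sum (norm v)\<^sup>2) UNIV"
      by (intro sums_nonneg_imp_has_sum)
         (use contraction_norm_le[OF T] in \<open>auto simp: b_def intro!: power_mono\<close>)
    moreover from this have "(\<lambda>k. (cmod (cinner h (orbit A f k)))\<^sup>2) summable_on (UNIV \<times> I)"
      by (intro summable_on_SigmaI[OF layer]) (auto intro: has_sum_imp_summable)
    ultimately show ?thesis
      unfolding v_def[symmetric] by (intro has_sum_SigmaI[OF layer]) auto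
  qed
  have lower: "1 / M\<^sup>2 * (norm h)\<^sup>2 \<le> (norm (inv L h))\<^sup>2" for h
    using L_sqr[of h] M(1) by (simp add: field_simps)
  have "1 / M\<^sup>2 > 0" "K\<^sup>2 > 0" using K M by simp_all
  moreover have "(\<lambda>k. (cmod (cinner h (orbit A f k)))\<^sup>2) summable_on UNIV \<times> I \<and>
      1 / M\<^sup>2 * (norm h)\<^sup>2 \<le> (\<Sum>\<^sub>\<infinity>k\<in>UNIV \<times> I. (cmod (cinner h (orbit A f k)))\<^sup>2) \<and>
      (\<Sum>\<^sub>\<infinity>k\<in>UNIV \<times> I. (cmod (cinner h (orbit A f k)))\<^sup>2) \<le> K\<^sup>2 * (norm h)\<^sup>2" for h
    unfolding infsumI[OF total] using has_sum_imp_summable[OF total] lower invL_sqr by blast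
  ultimately have "frame (UNIV \<times> I) (orbit A f)" unfolding frame_def by blast
  with \<open>bessel I f\<close> show ?thesis by blast
qed

section \<open>The characterisation\<close>

theorem theorem3p3:
  fixes A :: "'a::complex_hilbert \<Rightarrow> 'a"
  assumes "separable_space (euclidean :: 'a topology)"
    and "bounded_clinear A"
  shows
    "((\<exists>(I::nat set) f. bessel I f \<and> frame (UNIV \<times> I) (orbit A f)) \<longleftrightarrow>
        (\<exists>T. contraction T \<and> strongly_stable T \<and> similar_op (cadjoint A) T))
     \<and>
     ((\<exists>(I::nat set) f. finite I \<and> frame (UNIV \<times> I) (orbit A f)) \<longleftrightarrow>
        (\<exists>T. contraction T \<and> strongly_stable T \<and> similar_op (cadjoint A) T \<and>
           finite_cdim (range (\<lambda>x. x - cadjoint T (T x)))))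
     \<and>
     (\<forall>(I::'i set) f. countable I \<and> bessel I f \<and> frame (UNIV \<times> I) (orbit A f) \<longrightarrow>
        (let S = frame_operator (UNIV \<times> I) (orbit A f);
             T = sqrt_op S \<circ> cadjoint A \<circ> inv (sqrt_op S) in
           contraction T \<and> strongly_stable T \<and> similar_op (cadjoint A) T))
     \<and>
     (\<forall>(I::'i set) f. finite I \<and> frame (UNIV \<times> I) (orbit A f) \<longrightarrow>
        (let S = frame_operator (UNIV \<times> I) (orbit A f);
             T = sqrt_op S \<circ> cadjoint A \<circ> inv (sqrt_op S) in
           contraction T \<and> strongly_stable T \<and> similar_op (cadjoint A) T \<and>
           finite_cdim (range (\<lambda>x. x - cadjoint T (T x)))))"
    (is "(?frame1 \<longleftrightarrow> ?op1) \<and> (?frame2 \<longleftrightarrow> ?op2) \<and> ?formula1 \<and> ?formula2")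
proof -
  note A = assms(2)
  note forward = frame_contraction(1-3)[OF A]
  have finite_range:
    "finite_cdim (range (\<lambda>x. x - cadjoint (sqrt_op S \<circ> cadjoint A \<circ> inv (sqrt_op S))
        ((sqrt_op S \<circ> cadjoint A \<circ> inv (sqrt_op S)) x)))"
    if "finite I" "frame (UNIV \<times> I) (orbit A f)" "S = frame_operator (UNIV \<times> I) (orbit A f)"
    for I :: "'k set" and f S
    unfolding that(3)
    by (rule finite_cdim_defect[OF contraction_bounded_clinear[OF forward(1)[OF that(2)]] that(1)])
       (use frame_contraction(4)[OF A that(2)] that(1) in simp)
  have "?formula1" unfolding Let_def by (intro allI impI conjI forward; simp)
  moreover have "?formula2" unfolding Let_def by (intro allI impI conjI forward finite_range; simp)
  moreover have "?op1" if "?frame1"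
  proof -
    obtain I :: "nat set" and f where "frame (UNIV \<times> I) (orbit A f)" using \<open>?frame1\<close> by blast
    then show ?thesis using forward by blast
  qed
  moreover have "?op2" if "?frame2"
  proof -
    obtain I :: "nat set" and f where "finite I" and frame: "frame (UNIV \<times> I) (orbit A f)"
      using \<open>?frame2\<close> by blast
    then show ?thesis using forward[OF frame] finite_range[OF _ frame refl] by blast
  qed
  moreover have "?frame1" if "?op1"
  proof -
    obtain T where T: "contraction T" "strongly_stable T" "similar_op (cadjoint A) T" using \<open>?op1\<close> by blast
    obtain p :: "nat \<Rightarrow> 'a" where "\<And>u. (\<lambda>j. (cmod (cinner u (p j)))\<^sup>2) sums ((norm u)\<^sup>2 - (norm (T u))\<^sup>2)"
      using positive_op_rank_one_series[OF assms(1) positive_op_defect[OF T(1)]]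
      unfolding defect_form[OF T(1)] by blast
    then have "((\<lambda>j. (cmod (cinner u (p j)))\<^sup>2) has_sum ((norm u)\<^sup>2 - (norm (T u))\<^sup>2)) UNIV" for u
      by (rule sums_nonneg_imp_has_sum) simp
    then show ?thesis using frame_if_similar_to_stable_contraction[OF A T] by blast
  qed
  moreover have "?frame2" if "?op2"
  proof -
    obtain T where T: "contraction T" "strongly_stable T" "similar_op (cadjoint A) T"
      and fin: "finite_cdim (range (\<lambda>x. x - cadjoint T (T x)))" using \<open>?op2\<close> by blast
    obtain n and p :: "nat \<Rightarrow> 'a" where
      "\<And>u. (norm u)\<^sup>2 - (norm (T u))\<^sup>2 = (\<Sum>j<n. (cmod (cinner u (p j)))\<^sup>2)"
      using positive_op_rank_one_sum[OF positive_op_defect[OF T(1)] fin]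
      unfolding defect_form[OF T(1)] by blast
    then have "((\<lambda>j. (cmod (cinner u (p j)))\<^sup>2) has_sum ((norm u)\<^sup>2 - (norm (T u))\<^sup>2)) {..<n}" for u
      by (intro has_sum_finiteI) simp_all
    then show ?thesis using frame_if_similar_to_stable_contraction[OF A T] by blast
  qed
  ultimately show ?thesis by blast
qed

end
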